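(* Let $f:\Omega\to\mathbb{R}$ be bounded and continuous. Consider the IS-MP-QMCMC algorithm described in the context, with proposals $y^{(\ell)}_{1:N+1}$ and weights $w^{(\ell)}_i$, driven by the vectors $u^\ell=(v^\ell_1,\dots,v^\ell_{Nd+1})$, $v^\ell_r:=v_{\ell(Nd+1)+r}$, for a completely uniformly distributed (CUD) sequence $(v_i)_{i\ge0}$ in $(0,1)$. Assume that the underlying chain of accepted samples (one per iteration) is positive Harris with stationary distribution $\pi$ when driven by an IID uniform random seed, that it is regular, and that it has a coupling region $\mathcal C$. Then the sequence of estimators $$\mu_L=\frac1L\sum_{\ell=1}^L\sum_{i=1}^{N+1}w_i^{(\ell)}f\big(y_i^{(\ell)}\big),\qquad L\ge1,$$ is asymptotically unbiased, i.e. $\mathbb{E}[\mu_L]\to\int_\Omega f(x)\pi(x)\,dx$ as $L\to\infty$ (for a deterministic driving sequence, $\mathbb{E}[\mu_L]=\mu_L$).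
   Context: Let $d,N\in\mathbb{N}$, $\Omega\subset\mathbb{R}^d$, and $\pi$ a probability density (the target) on $\Omega$. For $y_{1:N+1}=(y_1,\dots,y_{N+1})\in\Omega^{N+1}$ write $y_{\setminus i}$ for the tuple with $y_i$ removed. For each $y\in\Omega$, $\kappa(y,\cdot)$ is a probability density on $\Omega^N$, and $\Psi_y:(0,1)^{Nd}\to\Omega^N$ is the inverse of its cumulative distribution function (sequential inversion of the one-dimensional conditional CDFs), so that $\Psi_y(U)\sim\kappa(y,\cdot)$ for $U$ uniform on $(0,1)^{Nd}$. IS-MP-QMCMC: start at some $x_0\in\Omega$. In iteration $\ell\ge1$, given the accepted sample $y_I=\tilde x$ of the previous iteration ($x_0$ in the first one) and the driving vector $u^\ell\in(0,1)^{Nd+1}$: (1) compute the $N$ new proposals $y_{\setminus I}=\Psi_{y_I}(u^\ell_1,\dots,u^\ell_{Nd})$, giving $y^{(\ell)}_{1:N+1}$; (2) compute the weights $w^{(\ell)}_i=\pi(y_i)\kappa(y_i,y_{\setminus i})/\sum_{j=1}^{N+1}\pi(y_j)\kappa(y_j,y_{\setminus j})$ and $\gamma_0=0$, $\gamma_j=\sum_{i=1}^jw^{(\ell)}_i$; (3) $\sum_iw_i^{(\ell)}f(y_i^{(\ell)})$ is the contribution of this iteration to the average $\mu_L$; (4) set $I=j$ and accepted sample $x_\ell=y_j$ for the $j$ with $u^\ell_{Nd+1}\in(\gamma_{j-1},\gamma_j]$. By convention the carried-over sample is placed at position $N+1$, so that the new accepted sample is a function $\phi(\tilde x,u)$ of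 the previous accepted sample and the driving vector. Coupling region: a set $\mathcal C\subset(0,1)^{Nd+1}$ of positive Jordan measure with $\phi(x,u)=\phi(x',u)$ for all $u\in\mathcal C$ and $x,x'\in\Omega$. Regular: for every $\ell\ge1$ and every bounded continuous $h:\Omega\to\mathbb{R}$, the function $(u^1,\dots,u^\ell)\mapsto h(x_\ell(u^1,\dots,u^\ell))$ on $(0,1)^{\ell(Nd+1)}$ is Riemann integrable. CUD: for points $z_1,\dots,z_n\in[0,1]^s$ the star discrepancy is $D^{*s}_n=\sup_{a\in(0,1]^s}\big|\frac1n\sum_{i=1}^n\mathbf 1_{(0,a]}(z_i)-\prod_{i=1}^sa_i\big|$. A sequence $(v_i)_i$ is CUD if for every $s\ge1$ the overlapping blocks $z_i=(v_i,\dots,v_{i+s-1})$ satisfy $D_n^{*s}(z_1,\dots,z_n)\to0$ as $n\to\infty$. Positive Harris means Harris recurrent with an invariant probability distribution. *)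

theory Defs
  imports "HOL-Probability.Probability"
begin

text \<open>
  Vectors whose dimension varies inside the statement, such as driving vectors, are extensional
  functions on \<open>{1..n}\<close>. The state space is a subset of \<open>real ^ 'd\<close>, so \<open>d = CARD('d)\<close>; the linear
  order on \<open>'d\<close> only fixes the order in which the coordinates are inverted.
  Tuples in \<open>\<Omega>\<^sup>N\<close> are the elements of \<open>{1..N} \<rightarrow>\<^sub>E \<Omega>\<close>.
\<close>

definition open_cube :: "nat \<Rightarrow> (nat \<Rightarrow> real) set" where
  "open_cube n = {1..n} \<rightarrow>\<^sub>E {0<..<1}"

definition closed_cube :: "nat \<Rightarrow> (nat \<Rightarrow> real) set" where
  "closed_cube n = {1..n} \<rightarrow>\<^sub>E {0..1}"

definition uniform_cube :: "nat \<Rightarrow> (nat \<Rightarrow> real) measure" where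
  "uniform_cube n = (\<Pi>\<^sub>M r\<in>{1..n}. restrict_space lborel {0<..<1})"


section \<open>Riemann (Darboux) integral and Jordan measure on the unit cube\<close>

text \<open>A grid has, for each coordinate \<open>i\<close>, nodes \<open>0 = t i 0 < \<dots> < t i (m i) = 1\<close>.\<close>

definition is_grid :: "nat \<Rightarrow> (nat \<Rightarrow> nat) \<times> (nat \<Rightarrow> nat \<Rightarrow> real) \<Rightarrow> bool" where
  "is_grid n = (\<lambda>(m, t). \<forall>i\<in>{1..n}. t i 0 = 0 \<and> t i (m i) = 1 \<and> (\<forall>j<m i. t i j < t i (Suc j)))"

definition grid_cell :: "nat \<Rightarrow> (nat \<Rightarrow> nat \<Rightarrow> real) \<Rightarrow> (nat \<Rightarrow> nat) \<Rightarrow> (nat \<Rightarrow> real) set" where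
  "grid_cell n t J = (\<Pi>\<^sub>E i\<in>{1..n}. {t i (J i)..t i (Suc (J i))})"

definition cell_volume :: "nat \<Rightarrow> (nat \<Rightarrow> nat \<Rightarrow> real) \<Rightarrow> (nat \<Rightarrow> nat) \<Rightarrow> real" where
  "cell_volume n t J = (\<Prod>i=1..n. t i (Suc (J i)) - t i (J i))"

definition upper_sum ::
    "nat \<Rightarrow> ((nat \<Rightarrow> real) \<Rightarrow> real) \<Rightarrow> (nat \<Rightarrow> nat) \<times> (nat \<Rightarrow> nat \<Rightarrow> real) \<Rightarrow> real" where
  "upper_sum n g = (\<lambda>(m, t). \<Sum>J\<in>(\<Pi>\<^sub>E i\<in>{1..n}. {..<m i}).
      cell_volume n t J * (SUP z\<in>grid_cell n t J. g z))"

definition lower_sum ::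
    "nat \<Rightarrow> ((nat \<Rightarrow> real) \<Rightarrow> real) \<Rightarrow> (nat \<Rightarrow> nat) \<times> (nat \<Rightarrow> nat \<Rightarrow> real) \<Rightarrow> real" where
  "lower_sum n g = (\<lambda>(m, t). \<Sum>J\<in>(\<Pi>\<^sub>E i\<in>{1..n}. {..<m i}).
      cell_volume n t J * (INF z\<in>grid_cell n t J. g z))"

definition upper_integral :: "nat \<Rightarrow> ((nat \<Rightarrow> real) \<Rightarrow> real) \<Rightarrow> real" where
  "upper_integral n g = (INF P\<in>Collect (is_grid n). upper_sum n g P)"

definition lower_integral :: "nat \<Rightarrow> ((nat \<Rightarrow> real) \<Rightarrow> real) \<Rightarrow> real" where
  "lower_integral n g = (SUP P\<in>Collect (is_grid n). lower_sum n g P)"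

definition riemann_integrable_cube :: "nat \<Rightarrow> ((nat \<Rightarrow> real) \<Rightarrow> real) \<Rightarrow> bool" where
  "riemann_integrable_cube n g \<longleftrightarrow>
     bounded (g ` closed_cube n) \<and> lower_integral n g = upper_integral n g"

text \<open>As usual, a function on the open cube is Riemann integrable if its extension by zero to the
  closed cube is.\<close>

definition riemann_integrable_open_cube :: "nat \<Rightarrow> ((nat \<Rightarrow> real) \<Rightarrow> real) \<Rightarrow> bool" where
  "riemann_integrable_open_cube n g \<longleftrightarrow>
     riemann_integrable_cube n (\<lambda>z. if z \<in> open_cube n then g z else 0)"

definition jordan_measurable :: "nat \<Rightarrow> (nat \<Rightarrow> real) set \<Rightarrow> bool" where
  "jordan_measurable n C \<longleftrightarrow> C \<subseteq> closed_cube n \<and> riemann_integrable_cube n (indicator C)"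

definition jordan_measure :: "nat \<Rightarrow> (nat \<Rightarrow> real) set \<Rightarrow> real" where
  "jordan_measure n C = upper_integral n (indicator C)"


section \<open>Completely uniformly distributed sequences\<close>

definition star_discrepancy :: "nat \<Rightarrow> nat \<Rightarrow> (nat \<Rightarrow> nat \<Rightarrow> real) \<Rightarrow> real" where
  "star_discrepancy s n z = (SUP a\<in>{1..s} \<rightarrow>\<^sub>E {0<..1}.
      \<bar>(\<Sum>i<n. indicator (\<Pi>\<^sub>E r\<in>{1..s}. {0<..a r}) (z i)) / real n - (\<Prod>r=1..s. a r)\<bar>)"

definition cud :: "(nat \<Rightarrow> real) \<Rightarrow> bool" where
  "cud v \<longleftrightarrow> (\<forall>s\<ge>1. (\<lambda>n. star_discrepancy s n (\<lambda>i. \<lambda>r\<in>{1..s}. v (i + r - 1))) \<longlonglongrightarrow> 0)"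

definition block :: "nat \<Rightarrow> (nat \<Rightarrow> real) \<Rightarrow> nat \<Rightarrow> (nat \<Rightarrow> real)" where
  "block s v l = (\<lambda>r\<in>{1..s}. v (l * s + r))"


section \<open>Markov chains given by an update function\<close>

primrec driven_chain :: "('a \<Rightarrow> 'u \<Rightarrow> 'a) \<Rightarrow> 'a \<Rightarrow> (nat \<Rightarrow> 'u) \<Rightarrow> nat \<Rightarrow> 'a" where
  "driven_chain F x U 0 = x"
| "driven_chain F x U (Suc l) = F (driven_chain F x U l) (U (Suc l))"

text \<open>In the following, \<open>S\<close> is the measurable state space and \<open>R\<close> the law of each seed; the seeds
  are IID. Measurability of the update function makes the recursion a Markov chain, whose
  transition kernel at \<open>x\<close> is \<open>distr R S (F x)\<close>.\<close>

definition markov_update :: "'a measure \<Rightarrow> 'u measure \<Rightarrow> ('a \<Rightarrow> 'u \<Rightarrow> 'a) \<Rightarrow> bool" where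
  "markov_update S R F \<longleftrightarrow> prob_space R \<and> (\<lambda>(x, u). F x u) \<in> S \<Otimes>\<^sub>M R \<rightarrow>\<^sub>M S"

definition invariant_distribution ::
    "'a measure \<Rightarrow> 'u measure \<Rightarrow> ('a \<Rightarrow> 'u \<Rightarrow> 'a) \<Rightarrow> 'a measure \<Rightarrow> bool" where
  "invariant_distribution S R F D \<longleftrightarrow> prob_space D \<and> sets D = sets S \<and>
     (\<forall>A\<in>sets S. (\<integral>\<^sup>+x. emeasure (distr R S (F x)) A \<partial>D) = emeasure D A)"

definition harris_recurrent :: "'a measure \<Rightarrow> 'u measure \<Rightarrow> ('a \<Rightarrow> 'u \<Rightarrow> 'a) \<Rightarrow> bool" where
  "harris_recurrent S R F \<longleftrightarrow> markov_update S R F \<and>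
     (\<exists>\<psi>. sets \<psi> = sets S \<and> sigma_finite_measure \<psi> \<and> emeasure \<psi> (space S) > 0 \<and>
       (\<forall>A\<in>sets S. emeasure \<psi> A > 0 \<longrightarrow>
         (\<forall>x\<in>space S. AE U in (\<Pi>\<^sub>M l\<in>UNIV. R). \<exists>\<^sub>\<infinity>l. driven_chain F x U l \<in> A)))"

definition positive_harris ::
    "'a measure \<Rightarrow> 'u measure \<Rightarrow> ('a \<Rightarrow> 'u \<Rightarrow> 'a) \<Rightarrow> 'a measure \<Rightarrow> bool" where
  "positive_harris S R F D \<longleftrightarrow> harris_recurrent S R F \<and> invariant_distribution S R F D"

definition coupling_region :: "nat \<Rightarrow> 'a set \<Rightarrow> ('a \<Rightarrow> (nat \<Rightarrow> real) \<Rightarrow> 'a) \<Rightarrow> (nat \<Rightarrow> real) set \<Rightarrow> bool"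
  where
  "coupling_region s \<Omega> F C \<longleftrightarrow> C \<subseteq> open_cube s \<and> jordan_measurable s C \<and> jordan_measure s C > 0 \<and>
     (\<forall>u\<in>C. \<forall>x\<in>\<Omega>. \<forall>x'\<in>\<Omega>. F x u = F x' u)"

text \<open>The vectors \<open>u\<^sup>1, \<dots>, u\<^sup>l\<close> are concatenated into one vector \<open>z\<close> of dimension \<open>l * s\<close>;
  \<open>block\<close> counts blocks from 0, hence the shift.\<close>

definition regular_update ::
    "nat \<Rightarrow> 'a::topological_space set \<Rightarrow> ('a \<Rightarrow> (nat \<Rightarrow> real) \<Rightarrow> 'a) \<Rightarrow> 'a \<Rightarrow> bool" where
  "regular_update s \<Omega> F x0 \<longleftrightarrow>
     (\<forall>l\<ge>1. \<forall>h. continuous_on \<Omega> h \<and> bounded (h ` \<Omega>) \<longrightarrow>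
        riemann_integrable_open_cube (l * s)
          (\<lambda>z. h (driven_chain F x0 (\<lambda>k. block s z (k - 1)) l)))"


section \<open>Densities and sequential inversion\<close>

definition prob_density_on :: "'a measure \<Rightarrow> 'a set \<Rightarrow> ('a \<Rightarrow> real) \<Rightarrow> bool" where
  "prob_density_on M A g \<longleftrightarrow> g \<in> borel_measurable (restrict_space M A) \<and> (\<forall>x\<in>A. 0 \<le> g x) \<and>
     (\<integral>\<^sup>+x\<in>A. ennreal (g x) \<partial>M) = 1"

text \<open>Identification of \<open>real\<^sup>N\<^sup>d\<close> with \<open>N\<close>-tuples of points of \<open>real\<^sup>d\<close>: the points one after the
  other, and the coordinates of each point in increasing order.\<close>

definition unflatten :: "nat \<Rightarrow> (nat \<Rightarrow> real) \<Rightarrow> nat \<Rightarrow> real ^ 'd::{finite,linorder}" where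
  "unflatten N z = (\<lambda>i\<in>{1..N}. \<chi> j. z ((i - 1) * CARD('d) + card {j'. j' \<le> j}))"

definition flat_density ::
    "nat \<Rightarrow> (real, 'd::{finite,linorder}) vec set \<Rightarrow> ((nat \<Rightarrow> (real, 'd) vec) \<Rightarrow> real) \<Rightarrow> (nat \<Rightarrow> real) \<Rightarrow> real"
  where
  "flat_density N \<Omega> k z = indicator ({1..N} \<rightarrow>\<^sub>E \<Omega>) (unflatten N z) * k (unflatten N z)"

text \<open>Distribution function of coordinate \<open>c\<close> given the coordinates \<open>z 1, \<dots>, z (c - 1)\<close>, for a
  density \<open>p\<close> on \<open>real\<^sup>n\<close>.\<close>

definition cond_cdf :: "nat \<Rightarrow> ((nat \<Rightarrow> real) \<Rightarrow> real) \<Rightarrow> nat \<Rightarrow> (nat \<Rightarrow> real) \<Rightarrow> real \<Rightarrow> real" where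
  "cond_cdf n p c z t =
     (\<integral>w. indicator {w. w c \<le> t} w * p (merge {1..<c} {c..n} (z, w)) \<partial>(\<Pi>\<^sub>M r\<in>{c..n}. lborel))
     / (\<integral>w. p (merge {1..<c} {c..n} (z, w)) \<partial>(\<Pi>\<^sub>M r\<in>{c..n}. lborel))"

primrec seq_inversion ::
    "nat \<Rightarrow> ((nat \<Rightarrow> real) \<Rightarrow> real) \<Rightarrow> (nat \<Rightarrow> real) \<Rightarrow> nat \<Rightarrow> (nat \<Rightarrow> real)" where
  "seq_inversion n p u 0 = (\<lambda>_. undefined)"
| "seq_inversion n p u (Suc c) = (seq_inversion n p u c)
     (Suc c := Inf {t. u (Suc c) \<le> cond_cdf n p (Suc c) (seq_inversion n p u c) t})"

text \<open>The map \<open>\<Psi>\<close> for the density \<open>k\<close>. Each conditional distribution function is inverted by its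
  quantile function (the \<open>Inf\<close> above), which is the inverse wherever one exists.\<close>

definition inverse_cdf ::
    "nat \<Rightarrow> (real, 'd::{finite,linorder}) vec set \<Rightarrow> ((nat \<Rightarrow> (real, 'd) vec) \<Rightarrow> real) \<Rightarrow>
     (nat \<Rightarrow> real) \<Rightarrow> (nat \<Rightarrow> (real, 'd) vec)" where
  "inverse_cdf N \<Omega> k u =
     unflatten N (seq_inversion (N * CARD('d)) (flat_density N \<Omega> k) u (N * CARD('d)))"


section \<open>Importance-sampling multiple-proposal quasi-MCMC\<close>

definition remove_at :: "nat \<Rightarrow> nat \<Rightarrow> (nat \<Rightarrow> 'a) \<Rightarrow> (nat \<Rightarrow> 'a)" where
  "remove_at N i y = (\<lambda>j\<in>{1..N}. if j < i then y j else y (Suc j))"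

text \<open>The carried-over sample occupies position \<open>N + 1\<close>.\<close>

definition points ::
    "nat \<Rightarrow> (real, 'd::{finite,linorder}) vec set \<Rightarrow> ((real, 'd) vec \<Rightarrow> (nat \<Rightarrow> (real, 'd) vec) \<Rightarrow> real) \<Rightarrow>
     (real, 'd) vec \<Rightarrow> (nat \<Rightarrow> real) \<Rightarrow> (nat \<Rightarrow> (real, 'd) vec)" where
  "points N \<Omega> \<kappa> x u = (inverse_cdf N \<Omega> (\<kappa> x) (restrict u {1..N * CARD('d)}))(N + 1 := x)"

definition raw_weight :: "nat \<Rightarrow> ('a \<Rightarrow> real) \<Rightarrow> ('a \<Rightarrow> (nat \<Rightarrow> 'a) \<Rightarrow> real) \<Rightarrow> (nat \<Rightarrow> 'a) \<Rightarrow> nat \<Rightarrow> real"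
  where
  "raw_weight N \<pi> \<kappa> y i = \<pi> (y i) * \<kappa> (y i) (remove_at N i y)"

text \<open>If all unnormalised weights vanish, the formula reads \<open>0 / 0\<close>; by convention the
  carried-over sample then receives the full weight, i.e. all new proposals are rejected.\<close>

definition weight :: "nat \<Rightarrow> ('a \<Rightarrow> real) \<Rightarrow> ('a \<Rightarrow> (nat \<Rightarrow> 'a) \<Rightarrow> real) \<Rightarrow> (nat \<Rightarrow> 'a) \<Rightarrow> nat \<Rightarrow> real"
  where
  "weight N \<pi> \<kappa> y i =
     (if (\<Sum>j=1..N+1. raw_weight N \<pi> \<kappa> y j) = 0 then (if i = N + 1 then 1 else 0)
      else raw_weight N \<pi> \<kappa> y i / (\<Sum>j=1..N+1. raw_weight N \<pi> \<kappa> y j))"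

definition cum_weight :: "nat \<Rightarrow> ('a \<Rightarrow> real) \<Rightarrow> ('a \<Rightarrow> (nat \<Rightarrow> 'a) \<Rightarrow> real) \<Rightarrow> (nat \<Rightarrow> 'a) \<Rightarrow> nat \<Rightarrow> real"
  where
  "cum_weight N \<pi> \<kappa> y j = (\<Sum>i=1..j. weight N \<pi> \<kappa> y i)"

definition accepted_index ::
    "nat \<Rightarrow> ('a \<Rightarrow> real) \<Rightarrow> ('a \<Rightarrow> (nat \<Rightarrow> 'a) \<Rightarrow> real) \<Rightarrow> (nat \<Rightarrow> 'a) \<Rightarrow> real \<Rightarrow> nat" where
  "accepted_index N \<pi> \<kappa> y t =
     (THE j. j \<in> {1..N+1} \<and> t \<in> {cum_weight N \<pi> \<kappa> y (j - 1)<..cum_weight N \<pi> \<kappa> y j})"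

text \<open>The update function \<open>\<phi>\<close> of the accepted samples.\<close>

definition mp_update ::
    "nat \<Rightarrow> (real, 'd::{finite,linorder}) vec set \<Rightarrow> ((real, 'd) vec \<Rightarrow> real) \<Rightarrow>
     ((real, 'd) vec \<Rightarrow> (nat \<Rightarrow> (real, 'd) vec) \<Rightarrow> real) \<Rightarrow> (real, 'd) vec \<Rightarrow> (nat \<Rightarrow> real) \<Rightarrow> (real, 'd) vec" where
  "mp_update N \<Omega> \<pi> \<kappa> x u =
     (let y = points N \<Omega> \<kappa> x u in y (accepted_index N \<pi> \<kappa> y (u (N * CARD('d) + 1))))"

definition mp_points ::
    "nat \<Rightarrow> (real, 'd::{finite,linorder}) vec set \<Rightarrow> ((real, 'd) vec \<Rightarrow> real) \<Rightarrow>
     ((real, 'd) vec \<Rightarrow> (nat \<Rightarrow> (real, 'd) vec) \<Rightarrow> real) \<Rightarrow> (real, 'd) vec \<Rightarrow> (nat \<Rightarrow> nat \<Rightarrow> real) \<Rightarrow>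
     nat \<Rightarrow> (nat \<Rightarrow> (real, 'd) vec)" where
  "mp_points N \<Omega> \<pi> \<kappa> x0 U l =
     points N \<Omega> \<kappa> (driven_chain (mp_update N \<Omega> \<pi> \<kappa>) x0 U (l - 1)) (U l)"

definition mp_estimator ::
    "nat \<Rightarrow> (real, 'd::{finite,linorder}) vec set \<Rightarrow> ((real, 'd) vec \<Rightarrow> real) \<Rightarrow>
     ((real, 'd) vec \<Rightarrow> (nat \<Rightarrow> (real, 'd) vec) \<Rightarrow> real) \<Rightarrow> ((real, 'd) vec \<Rightarrow> real) \<Rightarrow> (real, 'd) vec \<Rightarrow>
     (nat \<Rightarrow> nat \<Rightarrow> real) \<Rightarrow> nat \<Rightarrow> real" where
  "mp_estimator N \<Omega> \<pi> \<kappa> f x0 U L =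
     (1 / real L) * (\<Sum>l=1..L. \<Sum>i=1..N+1.
        weight N \<pi> \<kappa> (mp_points N \<Omega> \<pi> \<kappa> x0 U l) i * f (mp_points N \<Omega> \<pi> \<kappa> x0 U l i))"

end

theory Submission
  imports Defs
begin

text \<open>
  The last coordinate of the seed \<open>u\<^sup>l\<close> only selects the accepted proposal, hence
  \<open>\<Sum>\<^sub>i w\<^sub>i f(y\<^sub>i) = \<integral>\<^sub>0\<^sup>1 f(x\<^sub>l) dt\<close>, where \<open>t\<close> replaces that coordinate; by regularity this is
  sandwiched between step functions of the driving vectors with nearly equal integrals.

  Up to windows in which the chain does not couple, the \<open>l\<close>-th term is the same function of the
  last \<open>M + 1\<close> blocks, with the chain restarted at \<open>x\<^sub>0\<close>. The proportion of uncoupled windows is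
  \<open>O(1 / M)\<close> by a second moment bound. The windows are equidistributed along the non-overlapping
  blocks, although complete uniform distribution only speaks about overlapping ones: averages
  along multiples of \<open>s\<close> do not change when the sequence is replaced by its moving averages, and
  the mean square of these along multiples of \<open>s\<close> is at most \<open>s\<close> times that over all indices,
  which is small as disjoint windows are uncorrelated.

  So the averages tend to the expectation of \<open>f(x\<^sub>M\<^sub>+\<^sub>1)\<close> under independent uniform seeds, up to
  \<open>O(1 / M)\<close>. The coupling region makes the transition operator contract oscillations, so this
  expectation is exponentially close to that under the invariant distribution \<open>\<pi>\<close>.
\<close>

section \<open>Averages along sequences\<close>

text \<open>Cesaro convergence. The average at \<open>L = 0\<close> is \<open>0\<close> by the
  convention for division and does not affect the limit.\<close>

definition has_avg :: "(nat \<Rightarrow> real) \<Rightarrow> real \<Rightarrow> bool" where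
  "has_avg x c \<longleftrightarrow> (\<lambda>L. (\<Sum>l<L. x l) / real L) \<longlonglongrightarrow> c"

lemma has_avg_const: "has_avg (\<lambda>_. c) c"
  unfolding has_avg_def
  by (rule tendsto_eventually) (auto simp: eventually_sequentially intro!: exI[of _ 1])

lemma has_avg_add: "has_avg x a \<Longrightarrow> has_avg y b \<Longrightarrow> has_avg (\<lambda>l. x l + y l) (a + b)"
  unfolding has_avg_def sum.distrib add_divide_distrib by (rule tendsto_add)

lemma has_avg_diff: "has_avg x a \<Longrightarrow> has_avg y b \<Longrightarrow> has_avg (\<lambda>l. x l - y l) (a - b)"
  unfolding has_avg_def sum_subtractf diff_divide_distrib by (rule tendsto_diff)

lemma has_avg_cmult: "has_avg x a \<Longrightarrow> has_avg (\<lambda>l. c * x l) (c * a)"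
  unfolding has_avg_def sum_distrib_left[symmetric] times_divide_eq_right[symmetric]
  by (rule tendsto_mult_left)

lemma has_avg_sum:
  "finite A \<Longrightarrow> (\<And>k. k \<in> A \<Longrightarrow> has_avg (x k) (a k)) \<Longrightarrow>
     has_avg (\<lambda>l. \<Sum>k\<in>A. x k l) (\<Sum>k\<in>A. a k)"
proof (induction A rule: finite_induct)
  case empty
  then show ?case using has_avg_const[of 0] by simp
next
  case (insert k A)
  then show ?case using has_avg_add[of "x k" "a k"] by simp
qed

lemma has_avg_perturb:
  assumes "has_avg x a" "\<And>L. \<bar>(\<Sum>l<L. y l) - (\<Sum>l<L. x l)\<bar> \<le> K"
  shows "has_avg y a"
proof -
  have "(\<lambda>L. ((\<Sum>l<L. y l) - (\<Sum>l<L. x l)) / real L) \<longlonglongrightarrow> 0"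
  proof (rule tendsto_rabs_zero_cancel, rule tendsto_sandwich[OF _ _ tendsto_const])
    show "\<forall>\<^sub>F L in sequentially. 0 \<le> \<bar>((\<Sum>l<L. y l) - (\<Sum>l<L. x l)) / real L\<bar>" by simp
    show "\<forall>\<^sub>F L in sequentially. \<bar>((\<Sum>l<L. y l) - (\<Sum>l<L. x l)) / real L\<bar> \<le> K / real L"
      using assms(2) by (auto simp: divide_right_mono)
    show "(\<lambda>L. K / real L) \<longlonglongrightarrow> 0" by (rule lim_const_over_n)
  qed
  from tendsto_add[OF this assms(1)[unfolded has_avg_def]] show ?thesis
    by (simp add: has_avg_def diff_divide_distrib)
qed

text \<open>Cancelling the common terms leaves at most \<open>k\<close> terms at either end.\<close>

lemma sum_shift_diff_le:
  fixes x :: "nat \<Rightarrow> real"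
  assumes "\<And>l. \<bar>x l\<bar> \<le> B"
  shows "\<bar>(\<Sum>l<L. x (l + k)) - (\<Sum>l<L. x l)\<bar> \<le> 2 * B * real k"
proof -
  have "(\<Sum>l<L. x (l + k)) = (\<Sum>l<L + k. x l) - (\<Sum>l<k. x l)"
    by (induction L) simp_all
  moreover have "(\<Sum>l<L + k. x l) = (\<Sum>l<L. x l) + (\<Sum>l<k. x (l + L))"
    by (induction k) (simp_all add: add.commute)
  ultimately have "\<bar>(\<Sum>l<L. x (l + k)) - (\<Sum>l<L. x l)\<bar> = \<bar>(\<Sum>l<k. x (l + L)) - (\<Sum>l<k. x l)\<bar>"
    by simp
  also have "\<dots> \<le> \<bar>\<Sum>l<k. x (l + L)\<bar> + \<bar>\<Sum>l<k. x l\<bar>" by linarith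
  also have "\<dots> \<le> (\<Sum>l<k. B) + (\<Sum>l<k. B)"
    by (intro add_mono order.trans[OF sum_abs] sum_mono assms)
  finally show ?thesis by (simp add: mult_ac)
qed

lemma has_avg_shift:
  assumes "has_avg x a" "\<And>l. \<bar>x l\<bar> \<le> B"
  shows "has_avg (\<lambda>l. x (l + k)) a"
  by (rule has_avg_perturb[OF assms(1) sum_shift_diff_le[OF assms(2)]])

text \<open>The bounding sequences may change with \<open>e\<close>, and their limits only have to
  come within \<open>e\<close> of \<open>c\<close>: the averages of \<open>w\<close> are then
  eventually in every neighbourhood of \<open>c\<close>.\<close>

lemma has_avg_sandwich:
  assumes "\<And>e. e > 0 \<Longrightarrow> \<exists>x y a b. has_avg x a \<and> has_avg y b \<and> (\<forall>l. x l \<le> w l \<and> w l \<le> y l) \<and> c - e < a \<and> b < c + e"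
  shows "has_avg w c"
  unfolding has_avg_def
proof (rule order_tendstoI)
  fix d assume "d < c"
  then obtain x y a b where *: "has_avg x a" "\<forall>l. x l \<le> w l \<and> w l \<le> y l" "d < a"
    using assms[of "c - d"] by auto
  have "\<forall>\<^sub>F L in sequentially. d < (\<Sum>l<L. x l) / real L"
    using *(1,3) unfolding has_avg_def by (rule order_tendstoD)
  then show "\<forall>\<^sub>F L in sequentially. d < (\<Sum>l<L. w l) / real L"
  proof eventually_elim
    case (elim L)
    have "(\<Sum>l<L. x l) / real L \<le> (\<Sum>l<L. w l) / real L"
      using *(2) by (intro divide_right_mono sum_mono) auto
    with elim show ?case by linarith
  qed
next
  fix d assume "c < d"
  then obtain x y a b where *: "has_avg y b" "\<forall>l. x l \<le> w l \<and> w l \<le> y l" "b < d"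
    using assms[of "d - c"] by auto
  have "\<forall>\<^sub>F L in sequentially. (\<Sum>l<L. y l) / real L < d"
    using *(1,3) unfolding has_avg_def by (rule order_tendstoD)
  then show "\<forall>\<^sub>F L in sequentially. (\<Sum>l<L. w l) / real L < d"
  proof eventually_elim
    case (elim L)
    have "(\<Sum>l<L. w l) / real L \<le> (\<Sum>l<L. y l) / real L"
      using *(2) by (intro divide_right_mono sum_mono) auto
    with elim show ?case by linarith
  qed
qed

text \<open>Prefixing finitely many terms changes the partial sums by a constant; the induction
  prefixes one term at a time.\<close>

lemma has_avg_unshift:
  assumes "has_avg (\<lambda>l. x (l + k)) a"
  shows "has_avg x a"
  using assms
proof (induction k arbitrary: x)
  case (Suc k)
  have "has_avg (\<lambda>l. x (Suc l)) a" using Suc.IH[of "\<lambda>l. x (Suc l)"] Suc.prems by simp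
  then have lim: "(\<lambda>L. (\<Sum>l<L. x (Suc l)) / real L) \<longlonglongrightarrow> a" by (simp add: has_avg_def)
  have "(\<lambda>L. (\<Sum>l<L. x (Suc l)) / real L * (real L / real (Suc L)) + x 0 / real (Suc L)) \<longlonglongrightarrow> a * 1 + 0"
    by (intro tendsto_add tendsto_mult lim LIMSEQ_n_over_Suc_n LIMSEQ_Suc[OF lim_const_over_n])
  moreover have "(\<Sum>l<L. x (Suc l)) / real L * (real L / real (Suc L)) + x 0 / real (Suc L)
      = (\<Sum>l<Suc L. x l) / real (Suc L)" for L
  proof -
    have "(\<Sum>l<L. x (Suc l)) / real L * (real L / real (Suc L)) = (\<Sum>l<L. x (Suc l)) / real (Suc L)"
      by (cases "L = 0") auto
    then show ?thesis by (simp only: sum.lessThan_Suc_shift add_divide_distrib add.commute)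
  qed
  ultimately have "(\<lambda>L. (\<Sum>l<Suc L. x l) / real (Suc L)) \<longlonglongrightarrow> a" by simp
  then show ?case unfolding has_avg_def by (rule LIMSEQ_imp_Suc)
qed simp

text \<open>For comparisons that are available only from an index \<open>k\<close> on, where
  \<open>k\<close> depends on \<open>e\<close>. The first \<open>k\<close> terms are enclosed by
  \<open>- B\<close> and \<open>B\<close>, which leaves the limits of the averages
  unchanged.\<close>

lemma has_avg_sandwich_shift:
  assumes b: "\<And>l. \<bar>w l\<bar> \<le> B"
    and *: "\<And>e. e > 0 \<Longrightarrow> \<exists>k x y a b. has_avg x a \<and> has_avg y b \<and>
      (\<forall>l. x l \<le> w (l + k) \<and> w (l + k) \<le> y l) \<and> c - e < a \<and> b < c + e"
  shows "has_avg w c"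
proof (rule has_avg_sandwich)
  fix e :: real assume "e > 0"
  then obtain k x y a b where h: "has_avg x a" "has_avg y b"
    "\<And>l. x l \<le> w (l + k) \<and> w (l + k) \<le> y l" "c - e < a" "b < c + e"
    using * by metis
  define x' where "x' l = (if l < k then - B else x (l - k))" for l
  define y' where "y' l = (if l < k then B else y (l - k))" for l
  have "has_avg x' a" "has_avg y' b"
    by (rule has_avg_unshift[of _ k], simp add: x'_def y'_def h(1,2))+
  moreover have "x' l \<le> w l \<and> w l \<le> y' l" for l
    using h(3)[of "l - k"] b[of l] by (auto simp: x'_def y'_def abs_le_iff)
  ultimately show "\<exists>x y a b. has_avg x a \<and> has_avg y b \<and> (\<forall>l. x l \<le> w l \<and> w l \<le> y l) \<and> c - e < a \<and> b < c + e"
    using h(4,5) by blast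
qed

text \<open>Expand the square. The diagonal contributes at most \<open>1 / M\<close>, as the centred
  terms are bounded by 1; the off-diagonal products average to zero, as terms at lags
  \<open>d * q\<close> are asymptotically uncorrelated. \<open>E\<close> is the off-diagonal part
  and may be negative.\<close>

lemma moving_average_square_le:
  fixes x :: "nat \<Rightarrow> real"
  assumes x01: "\<And>i. x i \<in> {0..1}" and p: "has_avg x p" "p \<in> {0..1}"
    and lag: "\<And>d. d \<ge> 1 \<Longrightarrow> has_avg (\<lambda>i. x i * x (i + d * q)) (p\<^sup>2)"
    and M: "M \<ge> 1"
  obtains E where "has_avg E 0"
    "\<And>i. ((\<Sum>m<M. x (i + m * q) - p) / real M)\<^sup>2 \<le> 1 / real M + E i"
proof -
  define y where "y i = x i - p" for i
  have y1: "\<bar>y i\<bar> \<le> 1" for i using x01[of i] p(2) by (auto simp: y_def)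
  have lag_y: "has_avg (\<lambda>i. y i * y (i + d * q)) 0" if "d \<ge> 1" for d
  proof -
    have b: "\<bar>x i\<bar> \<le> 1" for i using x01[of i] by auto
    have "has_avg (\<lambda>i. x i * x (i + d * q) - p * x i - p * x (i + d * q) + p\<^sup>2)
        (p\<^sup>2 - p * p - p * p + p\<^sup>2)"
      by (intro has_avg_add has_avg_diff has_avg_cmult has_avg_const lag that p(1)
            has_avg_shift[OF p(1) b])
    also have "p\<^sup>2 - p * p - p * p + p\<^sup>2 = 0" by (simp add: power2_eq_square)
    finally show ?thesis
      by (simp add: y_def algebra_simps power2_eq_square)
  qed
  \<comment> \<open>This is the product at lag \<open>(m' - m) * q\<close>, read from index
    \<open>i + m * q\<close>.\<close>
  have off: "has_avg (\<lambda>i. y (i + m * q) * y (i + m' * q)) 0" if "m < m'" for m m'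
  proof -
    have "has_avg (\<lambda>i. (\<lambda>i. y i * y (i + (m' - m) * q)) (i + m * q)) 0"
      by (rule has_avg_shift[OF lag_y, where B = 1])
         (use that y1 in \<open>auto simp: abs_mult intro!: mult_le_one\<close>)
    moreover have "m * q + (m' - m) * q = m' * q"
      using that by (simp add: add_mult_distrib[symmetric])
    ultimately show ?thesis by (simp add: add.assoc)
  qed
  have off': "has_avg (\<lambda>i. y (i + m * q) * y (i + m' * q)) 0" if "m \<noteq> m'" for m m'
    using off[of m m'] off[of m' m] that by (cases "m < m'") (auto simp: mult.commute)
  define E where "E i = (1 / (real M)\<^sup>2) *
      (\<Sum>m<M. \<Sum>m'\<in>{..<M} - {m}. y (i + m * q) * y (i + m' * q))" for i
  have "has_avg E (1 / (real M)\<^sup>2 * (\<Sum>m<M. \<Sum>m'\<in>{..<M} - {m}. 0))"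
    unfolding E_def by (intro has_avg_cmult has_avg_sum off') auto
  then have "has_avg E 0" by simp
  moreover have "((\<Sum>m<M. x (i + m * q) - p) / real M)\<^sup>2 \<le> 1 / real M + E i" for i
  proof -
    have "(\<Sum>m<M. y (i + m * q))\<^sup>2
        = (\<Sum>m<M. \<Sum>m'<M. y (i + m * q) * y (i + m' * q))"
      by (simp add: power2_eq_square sum_product)
    also have "\<dots> = (\<Sum>m<M. y (i + m * q) * y (i + m * q)
         + (\<Sum>m'\<in>{..<M} - {m}. y (i + m * q) * y (i + m' * q)))"
      by (intro sum.cong sum.remove) auto
    also have "\<dots> = (\<Sum>m<M. y (i + m * q) * y (i + m * q)) + (real M)\<^sup>2 * E i"
      using M by (simp add: sum.distrib E_def)
    also have "(\<Sum>m<M. y (i + m * q) * y (i + m * q)) \<le> (\<Sum>m<M. 1)"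
      by (intro sum_mono) (use y1 in \<open>auto simp: abs_le_square_iff power2_eq_square\<close>,
         metis abs_le_square_iff abs_one one_power2 power2_eq_square)
    finally have "(\<Sum>m<M. y (i + m * q))\<^sup>2 / (real M)\<^sup>2
        \<le> (real M + (real M)\<^sup>2 * E i) / (real M)\<^sup>2"
      by (intro divide_right_mono) simp_all
    also have "\<dots> = 1 / real M + E i"
      using M by (simp add: field_simps power2_eq_square)
    finally show ?thesis by (simp add: power_divide y_def)
  qed
  ultimately show ?thesis by (rule that)
qed

lemma square_mean_le:
  fixes w :: "nat \<Rightarrow> real"
  shows "((\<Sum>l<L. w l) / real L)\<^sup>2 \<le> (\<Sum>l<L. (w l)\<^sup>2) / real L"
proof (cases "L = 0")
  case False
  have "(\<Sum>l<L. w l)\<^sup>2 \<le> real L * (\<Sum>l<L. (w l)\<^sup>2)"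
    using Cauchy_Schwarz_ineq_sum[of "\<lambda>_. 1" w "{..<L}"] by simp
  with False show ?thesis by (simp add: field_simps power2_eq_square)
qed simp

text \<open>The factor \<open>s\<close> enters here: the progression is a subset of the first
  \<open>L * s + c\<close> indices, and the omitted terms are nonnegative.\<close>

lemma sum_arith_prog_le:
  fixes w :: "nat \<Rightarrow> real"
  assumes "\<And>i. 0 \<le> w i" "s \<ge> 1"
  shows "(\<Sum>l<L. w (l * s + c)) \<le> (\<Sum>i<L * s + c. w i)"
proof -
  have "(\<Sum>l<L. w (l * s + c)) = (\<Sum>i\<in>(\<lambda>l. l * s + c) ` {..<L}. w i)"
    using assms(2) by (subst sum.reindex) (auto simp: inj_on_def)
  also have "\<dots> \<le> (\<Sum>i<L * s + c. w i)"
    by (intro sum_mono2) (use assms in auto)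
  finally show ?thesis .
qed

text \<open>The average over an arithmetic progression is compared with the average over its moving
  averages, whose mean square is at most \<open>s\<close> times the mean square over all indices.\<close>

lemma has_avg_arith_prog:
  fixes x :: "nat \<Rightarrow> real"
  assumes x01: "\<And>i. x i \<in> {0..1}" and p: "has_avg x p" "p \<in> {0..1}"
    and lag: "\<And>d. d \<ge> 1 \<Longrightarrow> has_avg (\<lambda>i. x i * x (i + d * q)) (p\<^sup>2)"
    and s: "s \<ge> 1" "s dvd q"
  shows "has_avg (\<lambda>l. x (l * s + c)) p"
proof -
  define y where "y i = x i - p" for i
  have y1: "\<bar>y i\<bar> \<le> 1" for i using x01[of i] p(2) by (auto simp: y_def)
  \<comment> \<open>A shift by \<open>q\<close> moves \<open>k\<close> steps along the progression,
    so moving averages over multiples of \<open>q\<close> stay on it.\<close>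
  obtain k where k: "q = k * s" using s(2) by (metis dvd_def mult.commute)
  have "has_avg (\<lambda>l. y (l * s + c)) 0"
    unfolding has_avg_def
  proof (rule LIMSEQ_I)
    fix e :: real assume e: "e > 0"
    \<comment> \<open>This choice makes \<open>s / M\<close>, the limit of the bound on the mean
      square, smaller than the square of \<open>e / 2\<close>.\<close>
    obtain M :: nat where M: "real M > 8 * real s / e\<^sup>2"
      using reals_Archimedean2 by blast
    moreover have "8 * real s / e\<^sup>2 \<ge> 0" by simp
    ultimately have M1: "M \<ge> 1" by (cases M) auto
    obtain E where E: "has_avg E 0"
      "\<And>i. ((\<Sum>m<M. x (i + m * q) - p) / real M)\<^sup>2 \<le> 1 / real M + E i"
      using moving_average_square_le[OF x01 p lag M1] by metis
    define W where "W i = (\<Sum>m<M. y (i + m * q)) / real M" for i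
    \<comment> \<open>Each of the \<open>M\<close> shifts moves by at most \<open>M * k\<close>
      steps, so passing to moving averages changes the sum by a bound independent of
      \<open>L\<close>.\<close>
    have near: "\<bar>(\<Sum>l<L. W (l * s + c)) - (\<Sum>l<L. y (l * s + c))\<bar> \<le> 2 * real (M * k)" for L
    proof -
      have "(\<Sum>l<L. W (l * s + c)) - (\<Sum>l<L. y (l * s + c))
          = (\<Sum>m<M. (\<Sum>l<L. y ((l + m * k) * s + c)) - (\<Sum>l<L. y (l * s + c))) / real M"
        using M1 by (simp add: W_def sum_subtractf sum_divide_distrib[symmetric] diff_divide_distrib
            sum.swap[of _ "{..<L}"] k algebra_simps)
      also have "\<bar>\<dots>\<bar> \<le> (\<Sum>m<M. 2 * real (M * k)) / real M"
        unfolding abs_divide abs_of_nat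
      proof (intro divide_right_mono order.trans[OF sum_abs] sum_mono)
        fix m assume m: "m \<in> {..<M}"
        have "\<bar>(\<Sum>l<L. y ((l + m * k) * s + c)) - (\<Sum>l<L. y (l * s + c))\<bar> \<le> 2 * 1 * real (m * k)"
          by (rule sum_shift_diff_le[where x = "\<lambda>l. y (l * s + c)"]) (rule y1)
        also have "\<dots> \<le> 2 * real (M * k)" using m by (simp add: mult_right_mono)
        finally show "\<bar>(\<Sum>l<L. y ((l + m * k) * s + c)) - (\<Sum>l<L. y (l * s + c))\<bar> \<le> 2 * real (M * k)" .
      qed simp
      finally show ?thesis using M1 by simp
    qed
    \<comment> \<open>Jensen's inequality, then the passage from the progression to all indices; the
      factor \<open>(L * s + c) / L\<close> tends to \<open>s\<close>.\<close>
    have W2: "((\<Sum>l<L. W (l * s + c)) / real L)\<^sup>2 \<le>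
        (real (L * s + c) / real L) * (1 / real M + (\<Sum>i<L * s + c. E i) / real (L * s + c))" if "L \<ge> 1" for L
    proof -
      have "((\<Sum>l<L. W (l * s + c)) / real L)\<^sup>2 \<le> (\<Sum>l<L. (W (l * s + c))\<^sup>2) / real L"
        by (rule square_mean_le)
      also have "\<dots> \<le> (\<Sum>i<L * s + c. (W i)\<^sup>2) / real L"
        using sum_arith_prog_le[of "\<lambda>i. (W i)\<^sup>2" s c L] s(1) by (simp add: divide_right_mono)
      also have "\<dots> \<le> (\<Sum>i<L * s + c. 1 / real M + E i) / real L"
        using E(2) by (intro divide_right_mono sum_mono) (auto simp: W_def y_def)
      also have "\<dots> = (real (L * s + c) / real L) * (1 / real M + (\<Sum>i<L * s + c. E i) / real (L * s + c))"
      proof -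
        have "real (L * s + c) > 0" using that s(1) by (simp add: add_pos_nonneg)
        then have "n * (1 / m + S / n) = n / m + S" if "n = real (L * s + c)" for n m S :: real
          using that by (simp add: field_simps)
        then show ?thesis by (simp add: sum.distrib)
      qed
      finally show ?thesis .
    qed
    have top: "filterlim (\<lambda>L. L * s + c) at_top sequentially"
      by (rule filterlim_at_top_mono[OF filterlim_ident])
         (use s(1) in \<open>auto intro!: always_eventually trans_le_add1\<close>)
    have "(\<lambda>L. (\<Sum>i<L * s + c. E i) / real (L * s + c)) \<longlonglongrightarrow> 0"
      using filterlim_compose[OF E(1)[unfolded has_avg_def] top] .
    moreover have "(\<lambda>L. real (L * s + c) / real L) \<longlonglongrightarrow> real s"
    proof (rule Lim_transform_eventually)
      show "(\<lambda>L. real s + real c / real L) \<longlonglongrightarrow> real s"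
        using tendsto_add[OF tendsto_const lim_const_over_n] by force
      show "\<forall>\<^sub>F L in sequentially. real s + real c / real L = real (L * s + c) / real L"
        using eventually_gt_at_top[of 0] by eventually_elim (simp add: field_simps)
    qed
    ultimately have "(\<lambda>L. (real (L * s + c) / real L) * (1 / real M + (\<Sum>i<L * s + c. E i) / real (L * s + c)))
        \<longlonglongrightarrow> real s * (1 / real M + 0)"
      by (intro tendsto_mult tendsto_add tendsto_const)
    moreover have "real s * (1 / real M + 0) < (e / 2)\<^sup>2"
    proof -
      have "real s / real M < e\<^sup>2 / 8"
      proof -
        have "8 * real s < real M * e\<^sup>2" using M e by (simp add: field_simps)
        then show ?thesis using M1 by (simp add: field_simps)
      qed
      also have "\<dots> \<le> (e / 2)\<^sup>2" by (simp add: power_divide)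
      finally show ?thesis by simp
    qed
    ultimately have ev1: "\<forall>\<^sub>F L in sequentially. (real (L * s + c) / real L) *
        (1 / real M + (\<Sum>i<L * s + c. E i) / real (L * s + c)) < (e / 2)\<^sup>2"
      by (rule order_tendstoD)
    have ev2: "\<forall>\<^sub>F L in sequentially. 2 * real (M * k) / real L < e / 2"
      by (rule order_tendstoD[OF lim_const_over_n]) (use e in simp)
    have "\<forall>\<^sub>F L in sequentially. norm ((\<Sum>l<L. y (l * s + c)) / real L - 0) < e"
      using ev1 ev2 eventually_ge_at_top[of 1]
    proof eventually_elim
      case (elim L)
      have "((\<Sum>l<L. W (l * s + c)) / real L)\<^sup>2 < (e / 2)\<^sup>2"
        using W2[OF elim(3)] elim(1) by linarith
      then have 1: "\<bar>(\<Sum>l<L. W (l * s + c)) / real L\<bar> < e / 2"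
        using e by (metis abs_of_pos half_gt_zero power2_abs power_less_imp_less_base less_imp_le)
      have "\<bar>((\<Sum>l<L. W (l * s + c)) - (\<Sum>l<L. y (l * s + c))) / real L\<bar> \<le> 2 * real (M * k) / real L"
        unfolding abs_divide abs_of_nat by (rule divide_right_mono[OF near]) simp
      with elim(2) have "\<bar>(\<Sum>l<L. W (l * s + c)) / real L - (\<Sum>l<L. y (l * s + c)) / real L\<bar> < e / 2"
        by (simp add: diff_divide_distrib)
      with 1 show ?case unfolding real_norm_def by linarith
    qed
    then show "\<exists>no. \<forall>L\<ge>no. norm ((\<Sum>l<L. y (l * s + c)) / real L - 0) < e"
      by (simp add: eventually_sequentially)
  qed
  from has_avg_add[OF this has_avg_const[of p]] show ?thesis by (simp add: y_def)
qed

section \<open>Equidistribution along non-overlapping blocks\<close>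

text \<open>The box is a \<open>PiE\<close>, whose members are extensional; hence the assumption on
  \<open>u\<close>.\<close>

lemma indicator_box_eq:
  assumes "u \<in> extensional I" "finite I"
  shows "indicator (\<Pi>\<^sub>E r\<in>I. A r) u = (\<Prod>r\<in>I. indicator (A r) (u r) :: real)"
proof (cases "\<forall>r\<in>I. u r \<in> A r")
  case True
  with assms(1) show ?thesis by (simp add: PiE_iff)
next
  case False
  then have "u \<notin> (\<Pi>\<^sub>E r\<in>I. A r)" by (auto simp: PiE_iff)
  with False assms(2) show ?thesis by (auto simp: indicator_def intro!: prod_zero[symmetric])
qed

text \<open>The lags in \<open>K\<close> are placed among the coordinates of a block of sufficient
  length \<open>s\<close>; all other coordinates get side length 1, a condition that every
  \<open>v i\<close> fulfils.\<close>

lemma cud_has_avg_corner: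
  assumes "cud v" and v: "\<And>i. v i \<in> {0<..<1}" and K: "finite K"
    and b: "\<And>r. r \<in> K \<Longrightarrow> 0 \<le> b r \<and> b r \<le> 1"
  shows "has_avg (\<lambda>i. \<Prod>r\<in>K. indicator {0<..b r} (v (i + r))) (\<Prod>r\<in>K. b r)"
proof (cases "\<exists>r\<in>K. b r = 0")
  \<comment> \<open>The star discrepancy tests only boxes with positive sides. If a side is empty,
    the indicators and the volume all vanish.\<close>
  case True
  then have "(\<Prod>r\<in>K. b r) = 0" "(\<Prod>r\<in>K. indicator {0<..b r} (v (i + r))) = (0::real)" for i
    using K by (auto intro!: prod_zero bexI)
  then show ?thesis using has_avg_const[of 0] by simp
next
  case False
  obtain s where s: "s \<ge> 1" "K \<subseteq> {..<s}"
  proof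
    show "Suc (Max K) \<ge> 1" by simp
    show "K \<subseteq> {..<Suc (Max K)}" using K by (auto simp: less_Suc_eq_le)
  qed
  \<comment> \<open>Coordinate \<open>r\<close> of a block is \<open>v (i + r - 1)\<close>, so lag
    \<open>r\<close> is coordinate \<open>r + 1\<close>.\<close>
  define a where "a = (\<lambda>r\<in>{1..s}. if r - 1 \<in> K then b (r - 1) else 1)"
  have a: "a \<in> {1..s} \<rightarrow>\<^sub>E {0<..1}"
    using b False by (force simp: a_def less_le)
  define z where "z i = (\<lambda>r\<in>{1..s}. v (i + r - 1))" for i
  have shift: "(\<Prod>r=1..s. g r) = (\<Prod>r<s. g (Suc r))" for g :: "nat \<Rightarrow> real"
    using prod.shift_bounds_cl_Suc_ivl[of g 0 "s - 1"] s(1)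
    by (simp add: prod.atLeast1_atMost_eq)
  have prod_a: "(\<Prod>r=1..s. a r) = (\<Prod>r\<in>K. b r)"
    unfolding shift using s(2) by (intro prod.mono_neutral_cong_right) (auto simp: a_def)
  have ind: "indicator (\<Pi>\<^sub>E r\<in>{1..s}. {0<..a r}) (z i)
      = (\<Prod>r\<in>K. indicator {0<..b r} (v (i + r)) :: real)" for i
  proof -
    have "indicator (\<Pi>\<^sub>E r\<in>{1..s}. {0<..a r}) (z i) = (\<Prod>r=1..s. indicator {0<..a r} (z i r) :: real)"
      by (rule indicator_box_eq) (simp_all add: z_def)
    also have "\<dots> = (\<Prod>r\<in>K. indicator {0<..b r} (v (i + r)))"
      unfolding shift using s(2) v
      by (intro prod.mono_neutral_cong_right) (auto simp: a_def z_def indicator_def less_imp_le)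
    finally show ?thesis .
  qed
  \<comment> \<open>The supremum in the discrepancy is an upper bound only because the set under it
    is bounded.\<close>
  have bound: "\<bar>(\<Sum>i<n. indicator (\<Pi>\<^sub>E r\<in>{1..s}. {0<..a r}) (z i)) / real n - (\<Prod>r=1..s. a r)\<bar> \<le> 1"
    if "a \<in> {1..s} \<rightarrow>\<^sub>E {0<..1}" for a n
  proof -
    have "(\<Sum>i<n. indicator (\<Pi>\<^sub>E r\<in>{1..s}. {0<..a r}) (z i)) \<le> (\<Sum>i<n. 1::real)"
      by (intro sum_mono) (auto simp: indicator_def)
    then have "(\<Sum>i<n. indicator (\<Pi>\<^sub>E r\<in>{1..s}. {0<..a r}) (z i)) / real n \<le> 1"
      by (auto simp: divide_le_eq)
    moreover have "(\<Sum>i<n. indicator (\<Pi>\<^sub>E r\<in>{1..s}. {0<..a r}) (z i)) / real n \<ge> 0"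
      by (intro divide_nonneg_nonneg sum_nonneg) auto
    moreover have "(\<Prod>r=1..s. a r) \<ge> 0" "(\<Prod>r=1..s. a r) \<le> 1"
      using that by (auto intro!: prod_nonneg prod_le_1 simp: PiE_iff less_imp_le)
    ultimately show ?thesis by (simp add: abs_le_iff)
  qed
  have "(\<lambda>n. (\<Sum>i<n. indicator (\<Pi>\<^sub>E r\<in>{1..s}. {0<..a r}) (z i)) / real n - (\<Prod>r=1..s. a r)) \<longlonglongrightarrow> 0"
  proof (rule tendsto_rabs_zero_cancel, rule tendsto_sandwich[OF _ _ tendsto_const])
    show "(\<lambda>n. star_discrepancy s n z) \<longlonglongrightarrow> 0"
      using assms(1) s(1) unfolding cud_def z_def by blast
    show "\<forall>\<^sub>F n in sequentially. \<bar>(\<Sum>i<n. indicator (\<Pi>\<^sub>E r\<in>{1..s}. {0<..a r}) (z i)) / real n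
        - (\<Prod>r=1..s. a r)\<bar> \<le> star_discrepancy s n z"
      unfolding star_discrepancy_def
      by (intro always_eventually allI cSUP_upper[OF a] bdd_aboveI2[where M = 1] bound)
  qed simp
  from tendsto_add[OF this[unfolded ind prod_a] tendsto_const[of "\<Prod>r\<in>K. b r"]] show ?thesis
    by (simp add: has_avg_def)
qed

text \<open>The intervals \<open>{a r<..b r}\<close> are introduced one coordinate at a time.\<close>

lemma cud_has_avg_box:
  assumes "cud v" and v: "\<And>i. v i \<in> {0<..<1}" and "finite K"
    and ab: "\<And>r. r \<in> K \<Longrightarrow> 0 \<le> a r \<and> a r \<le> b r \<and> b r \<le> 1"
  shows "has_avg (\<lambda>i. \<Prod>r\<in>K. indicator {a r<..b r} (v (i + r))) (\<Prod>r\<in>K. b r - a r)"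
proof -
  \<comment> \<open>Mixed boxes: general intervals on \<open>A\<close>, intervals starting at 0 on
    \<open>K'\<close>. The induction step moves \<open>x\<close> into \<open>K'\<close>, once with
    endpoint \<open>b x\<close> and once with \<open>a x\<close>, and subtracts.\<close>
  have "has_avg (\<lambda>i. (\<Prod>r\<in>A. indicator {a r<..b r} (v (i + r)))
          * (\<Prod>r\<in>K'. indicator {0<..b' r} (v (i + r)))) ((\<Prod>r\<in>A. b r - a r) * (\<Prod>r\<in>K'. b' r))"
    if "finite A" "A \<subseteq> K" "finite K'" "A \<inter> K' = {}" "\<And>r. r \<in> K' \<Longrightarrow> 0 \<le> b' r \<and> b' r \<le> 1" for A K' b'
    using that
  proof (induction A arbitrary: K' b' rule: finite_induct)
    case empty
    then show ?case using cud_has_avg_corner[OF assms(1) v, of K' b'] by simp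
  next
    case (insert x A)
    have x: "0 \<le> a x" "a x \<le> b x" "b x \<le> 1" "x \<notin> K'" using ab[of x] insert.prems by auto
    define P where "P i = (\<Prod>r\<in>A. indicator {a r<..b r} (v (i + r)) :: real)" for i
    define Q where "Q i = (\<Prod>r\<in>K'. indicator {0<..b' r} (v (i + r)) :: real)" for i
    have IH: "has_avg (\<lambda>i. P i * (indicator {0<..c} (v (i + x)) * Q i))
        ((\<Prod>r\<in>A. b r - a r) * (c * (\<Prod>r\<in>K'. b' r)))" if "0 \<le> c" "c \<le> 1" for c
    proof -
      have "has_avg (\<lambda>i. P i * (\<Prod>r\<in>insert x K'. indicator {0<..(b'(x := c)) r} (v (i + r))))
        ((\<Prod>r\<in>A. b r - a r) * (\<Prod>r\<in>insert x K'. (b'(x := c)) r))"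
        unfolding P_def using insert that by (intro insert.IH) auto
      moreover have "(\<Prod>r\<in>insert x K'. indicator {0<..(b'(x := c)) r} (v (i + r)))
          = (indicator {0<..c} (v (i + x)) * Q i :: real)" for i
        using insert.prems x(4) by (auto simp: Q_def intro!: prod.cong)
      moreover have "(\<Prod>r\<in>insert x K'. (b'(x := c)) r) = c * (\<Prod>r\<in>K'. b' r)"
        using insert.prems x(4) by (auto intro!: prod.cong)
      ultimately show ?thesis by simp
    qed
    have ind: "indicator {a x<..b x} t = (indicator {0<..b x} t - indicator {0<..a x} t :: real)" for t
      using x by (auto simp: indicator_def)
    have "(\<Prod>r\<in>insert x A. indicator {a r<..b r} (v (i + r))) * Q i
        = P i * (indicator {0<..b x} (v (i + x)) * Q i) - P i * (indicator {0<..a x} (v (i + x)) * Q i)" for i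
      unfolding P_def prod.insert[OF insert.hyps] ind by (simp add: algebra_simps)
    moreover have "(\<Prod>r\<in>insert x A. b r - a r) * (\<Prod>r\<in>K'. b' r)
        = (\<Prod>r\<in>A. b r - a r) * (b x * (\<Prod>r\<in>K'. b' r)) - (\<Prod>r\<in>A. b r - a r) * (a x * (\<Prod>r\<in>K'. b' r))"
      using insert.hyps by (simp add: algebra_simps)
    ultimately show ?case
      using has_avg_diff[OF IH[of "b x"] IH[of "a x"]] x by (simp add: Q_def)
  qed
  from this[of K "{}"] show ?thesis using assms(3) by simp
qed

text \<open>Supplies the lag correlations. The translated box restricts coordinates outside
  \<open>K\<close>, so the two boxes together form a single box over \<open>K\<close> and its
  translate.\<close>

lemma box_product_lag:
  fixes a b :: "nat \<Rightarrow> real"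
  assumes K: "finite K" "\<And>r. r \<in> K \<Longrightarrow> r + e \<notin> K"
    and ab: "\<And>r. r \<in> K \<Longrightarrow> 0 \<le> a r \<and> a r \<le> b r \<and> b r \<le> 1"
  obtains K' a' b' where "finite K'" "\<And>r. r \<in> K' \<Longrightarrow> 0 \<le> a' r \<and> a' r \<le> b' r \<and> b' r \<le> (1::real)"
    "\<And>w. (\<Prod>r\<in>K. indicator {a r<..b r} (w r)) * (\<Prod>r\<in>K. indicator {a r<..b r} (w (r + e)))
       = (\<Prod>r\<in>K'. indicator {a' r<..b' r} (w r) :: real)"
    "(\<Prod>r\<in>K'. b' r - a' r) = (\<Prod>r\<in>K. b r - a r)\<^sup>2"
proof -
  define K' where "K' = K \<union> (\<lambda>r. r + e) ` K"
  define a' where "a' r = (if r \<in> K then a r else a (r - e))" for r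
  define b' where "b' r = (if r \<in> K then b r else b (r - e))" for r
  have split: "(\<Prod>r\<in>K'. g r) = (\<Prod>r\<in>K. g r) * (\<Prod>r\<in>K. g (r + e))" for g :: "nat \<Rightarrow> real"
    unfolding K'_def using K by (subst prod.union_disjoint) (auto simp: prod.reindex)
  show ?thesis
  proof (rule that[of K' a' b'])
    show "finite K'" using K(1) by (simp add: K'_def)
    show "0 \<le> a' r \<and> a' r \<le> b' r \<and> b' r \<le> 1" if "r \<in> K'" for r
      using that ab by (auto simp: K'_def a'_def b'_def)
    show "(\<Prod>r\<in>K'. b' r - a' r) = (\<Prod>r\<in>K. b r - a r)\<^sup>2"
      unfolding split using K(2) by (simp add: a'_def b'_def power2_eq_square cong: prod.cong)
    show "(\<Prod>r\<in>K. indicator {a r<..b r} (w r)) * (\<Prod>r\<in>K. indicator {a r<..b r} (w (r + e)))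
       = (\<Prod>r\<in>K'. indicator {a' r<..b' r} (w r) :: real)" for w
      unfolding split using K(2) by (simp add: a'_def b'_def cong: prod.cong)
  qed
qed

text \<open>The step from overlapping to non-overlapping blocks. With \<open>n\<close> beyond all
  lags in \<open>K\<close>, translates by positive multiples of \<open>s * n\<close> restrict
  coordinates disjoint from \<open>K\<close>, so the correlations factorise; and \<open>s\<close>
  divides \<open>s * n\<close>.\<close>

lemma cud_has_avg_box_arith_prog:
  assumes "cud v" and v: "\<And>i. v i \<in> {0<..<1}" and K: "finite K"
    and ab: "\<And>r. r \<in> K \<Longrightarrow> 0 \<le> a r \<and> a r \<le> b r \<and> b r \<le> 1" and s: "s \<ge> 1"
  shows "has_avg (\<lambda>l. \<Prod>r\<in>K. indicator {a r<..b r} (v (l * s + c + r))) (\<Prod>r\<in>K. b r - a r)"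
proof -
  define n where "n = Suc (Max K)"
  have n: "K \<subseteq> {..<n}" using K by (auto simp: n_def less_Suc_eq_le)
  show ?thesis
  proof (rule has_avg_arith_prog[where q = "s * n" and s = s and c = c])
    show "(\<Prod>r\<in>K. indicator {a r<..b r} (v (i + r))) \<in> {0..1::real}" for i
      by (auto intro!: prod_nonneg prod_le_1)
    show "has_avg (\<lambda>i. \<Prod>r\<in>K. indicator {a r<..b r} (v (i + r))) (\<Prod>r\<in>K. b r - a r)"
      by (rule cud_has_avg_box) (use assms in auto)
    show "(\<Prod>r\<in>K. b r - a r) \<in> {0..1}"
      using ab by (auto intro!: prod_nonneg prod_le_1) fastforce
    show "has_avg (\<lambda>i. (\<Prod>r\<in>K. indicator {a r<..b r} (v (i + r)))
        * (\<Prod>r\<in>K. indicator {a r<..b r} (v (i + d * (s * n) + r)))) ((\<Prod>r\<in>K. b r - a r)\<^sup>2)" if "d \<ge> 1" for d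
    proof -
      define e where "e = d * (s * n)"
      have e: "e \<ge> n" using that s by (simp add: e_def)
      have notin: "\<And>r. r \<in> K \<Longrightarrow> r + e \<notin> K" using n e by auto
      show ?thesis
      proof (rule box_product_lag[OF K notin ab])
        fix K' a' b'
        assume K': "finite K'" "\<And>r. r \<in> K' \<Longrightarrow> 0 \<le> a' r \<and> a' r \<le> b' r \<and> b' r \<le> (1::real)"
          and eq: "\<And>w. (\<Prod>r\<in>K. indicator {a r<..b r} (w r)) * (\<Prod>r\<in>K. indicator {a r<..b r} (w (r + e)))
            = (\<Prod>r\<in>K'. indicator {a' r<..b' r} (w r) :: real)"
          and vol: "(\<Prod>r\<in>K'. b' r - a' r) = (\<Prod>r\<in>K. b r - a r)\<^sup>2"
        have "(\<Prod>r\<in>K. indicator {a r<..b r} (v (i + r))) * (\<Prod>r\<in>K. indicator {a r<..b r} (v (i + d * (s * n) + r)))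
            = (\<Prod>r\<in>K'. indicator {a' r<..b' r} (v (i + r)) :: real)" for i
          using eq[of "\<lambda>r. v (i + r)"] by (simp add: e_def ac_simps)
        moreover have "has_avg (\<lambda>i. \<Prod>r\<in>K'. indicator {a' r<..b' r} (v (i + r))) (\<Prod>r\<in>K'. b' r - a' r)"
          by (rule cud_has_avg_box[OF assms(1) v K'(1)]) (use K'(2) in auto)
        ultimately show ?thesis by (simp only: vol)
      qed
    qed
  qed (use s in auto)
qed

section \<open>Step functions on grids\<close>

text \<open>Unlike the closed cells of the Darboux sums, the half-open cells partition
  \<open>(0, 1]\<^sup>n\<close>, and their indicators are differences of those of the boxes \<open>(0, a]\<close>.\<close>

definition grid_step ::
    "nat \<Rightarrow> (nat \<Rightarrow> nat) \<times> (nat \<Rightarrow> nat \<Rightarrow> real) \<Rightarrow> ((nat \<Rightarrow> nat) \<Rightarrow> real) \<Rightarrow> (nat \<Rightarrow> real) \<Rightarrow> real" where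
  "grid_step n = (\<lambda>(m, t) c z. \<Sum>J\<in>(\<Pi>\<^sub>E i\<in>{1..n}. {..<m i}).
      c J * (\<Prod>i=1..n. indicator {t i (J i)<..t i (Suc (J i))} (z i)))"

definition grid_step_integral ::
    "nat \<Rightarrow> (nat \<Rightarrow> nat) \<times> (nat \<Rightarrow> nat \<Rightarrow> real) \<Rightarrow> ((nat \<Rightarrow> nat) \<Rightarrow> real) \<Rightarrow> real" where
  "grid_step_integral n = (\<lambda>(m, t) c. \<Sum>J\<in>(\<Pi>\<^sub>E i\<in>{1..n}. {..<m i}). c J * cell_volume n t J)"

lemma is_grid_mono:
  assumes "is_grid n (m, t)" "i \<in> {1..n}" "j \<le> k" "k \<le> m i"
  shows "t i j \<le> t i k"
  using assms(3,4)
proof (induction k rule: dec_induct)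
  case (step k)
  then have "t i k < t i (Suc k)" using assms(1,2) by (auto simp: is_grid_def)
  with step show ?case by simp
qed simp

lemma is_grid_node:
  assumes "is_grid n (m, t)" "i \<in> {1..n}" "j \<le> m i"
  shows "t i j \<in> {0..1}"
  using is_grid_mono[OF assms(1,2), of 0 j] is_grid_mono[OF assms(1,2), of j "m i"] assms
  by (auto simp: is_grid_def)

lemma is_grid_interval:
  assumes "is_grid n (m, t)" "J \<in> (\<Pi>\<^sub>E i\<in>{1..n}. {..<m i})" "i \<in> {1..n}"
  shows "0 \<le> t i (J i)" "t i (J i) < t i (Suc (J i))" "t i (Suc (J i)) \<le> 1"
proof -
  have J: "J i < m i" using assms(2,3) by auto
  show "0 \<le> t i (J i)" "t i (Suc (J i)) \<le> 1"
    using is_grid_node[OF assms(1,3), of "J i"] is_grid_node[OF assms(1,3), of "Suc (J i)"] J by auto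
  show "t i (J i) < t i (Suc (J i))" using assms(1,3) J by (auto simp: is_grid_def)
qed

text \<open>In each coordinate the interval is found from the least node not below
  \<open>z i\<close>. The nodes increase, so no other interval contains \<open>z i\<close> and a
  single summand survives. The cell \<open>J\<close> is the same for all coefficients
  \<open>c\<close>.\<close>

lemma grid_step_eq:
  assumes g: "is_grid n (m, t)" and z: "\<And>i. i \<in> {1..n} \<Longrightarrow> z i \<in> {0<..1}"
  obtains J where "J \<in> (\<Pi>\<^sub>E i\<in>{1..n}. {..<m i})"
    "\<And>i. i \<in> {1..n} \<Longrightarrow> z i \<in> {t i (J i)<..t i (Suc (J i))}"
    "\<And>c. grid_step n (m, t) c z = c J"
proof -
  have "\<exists>j. j < m i \<and> z i \<in> {t i j<..t i (Suc j)} \<and> (\<forall>j'<m i. j' \<noteq> j \<longrightarrow> z i \<notin> {t i j'<..t i (Suc j')})"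
    if i: "i \<in> {1..n}" for i
  proof -
    have ti: "t i 0 = 0" "t i (m i) = 1" using g i by (auto simp: is_grid_def)
    have "z i \<le> t i (m i)" "\<not> z i \<le> t i 0" using z[OF i] ti by auto
    then obtain j where j: "j < m i" "z i \<le> t i (Suc j)" "\<not> z i \<le> t i j"
      using ex_least_nat_less[of "\<lambda>j. z i \<le> t i j" "m i"] by auto
    have "z i \<notin> {t i j'<..t i (Suc j')}" if "j' < m i" "j' \<noteq> j" for j'
    proof (cases "j' < j")
      case True
      then have "t i (Suc j') \<le> t i j" using is_grid_mono[OF g i, of "Suc j'" j] j by auto
      then show ?thesis using j by auto
    next
      case False
      then have "t i (Suc j) \<le> t i j'" using is_grid_mono[OF g i, of "Suc j" j'] that by auto
      then show ?thesis using j by auto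
    qed
    with j show ?thesis by force
  qed
  then obtain j where j: "\<And>i. i \<in> {1..n} \<Longrightarrow> j i < m i \<and> z i \<in> {t i (j i)<..t i (Suc (j i))} \<and>
      (\<forall>j'<m i. j' \<noteq> j i \<longrightarrow> z i \<notin> {t i j'<..t i (Suc j')})"
    by metis
  define J where "J = restrict j {1..n}"
  have JP: "J \<in> (\<Pi>\<^sub>E i\<in>{1..n}. {..<m i})" using j by (auto simp: J_def)
  have zJ: "z i \<in> {t i (J i)<..t i (Suc (J i))}" if "i \<in> {1..n}" for i
    using j[OF that] that by (simp add: J_def)
  have "grid_step n (m, t) c z = c J" for c
  proof -
    have fin: "finite (\<Pi>\<^sub>E i\<in>{1..n}. {..<m i})" by (intro finite_PiE) auto
    have other: "(\<Prod>i=1..n. indicator {t i (J' i)<..t i (Suc (J' i))} (z i)) = (0::real)"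
      if J': "J' \<in> (\<Pi>\<^sub>E i\<in>{1..n}. {..<m i})" "J' \<noteq> J" for J'
    proof -
      obtain i where i: "i \<in> {1..n}" "J' i \<noteq> J i"
        using PiE_ext[OF J'(1) JP] J'(2) by blast
      then have "z i \<notin> {t i (J' i)<..t i (Suc (J' i))}"
        using j[OF i(1)] J'(1) by (auto simp: J_def PiE_iff)
      then show ?thesis using i(1) by (intro prod_zero bexI[of _ i]) (auto simp: indicator_def)
    qed
    have one: "(\<Prod>i=1..n. indicator {t i (J i)<..t i (Suc (J i))} (z i)) = (1::real)"
      using zJ by (intro prod.neutral) auto
    have "(\<Sum>J'\<in>(\<Pi>\<^sub>E i\<in>{1..n}. {..<m i}) - {J}.
        c J' * (\<Prod>i=1..n. indicator {t i (J' i)<..t i (Suc (J' i))} (z i))) = 0"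
      by (rule sum.neutral) (use other in auto)
    then show ?thesis
      unfolding grid_step_def split_conv sum.remove[OF fin JP] one by simp
  qed
  with JP zJ show ?thesis by (rule that)
qed

lemma grid_cell_subset_closed_cube:
  assumes "is_grid n (m, t)" "J \<in> (\<Pi>\<^sub>E i\<in>{1..n}. {..<m i})"
  shows "grid_cell n t J \<subseteq> closed_cube n"
  unfolding grid_cell_def closed_cube_def
proof (rule PiE_mono)
  fix i assume "i \<in> {1..n}"
  from is_grid_interval[OF assms this] show "{t i (J i)..t i (Suc (J i))} \<subseteq> {0..1}" by auto
qed

text \<open>The one-cell grid, which makes the sets of Darboux sums nonempty.\<close>

lemma is_grid_ex: "is_grid n (\<lambda>_. 1, \<lambda>_ j. real j)"
  by (simp add: is_grid_def)

section \<open>Approximation of Darboux integrals by step functions\<close>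

lemma upper_integral_lessD:
  assumes "upper_integral n g < y"
  obtains m t where "is_grid n (m, t)" "upper_sum n g (m, t) < y"
proof -
  have "\<exists>z\<in>upper_sum n g ` Collect (is_grid n). z < y"
    by (rule cInf_lessD[OF _ assms[unfolded upper_integral_def]]) (use is_grid_ex[of n] in blast)
  then obtain P where "is_grid n P" "upper_sum n g P < y" by auto
  then show ?thesis using that[of "fst P" "snd P"] by simp
qed

lemma less_lower_integralD:
  assumes "y < lower_integral n g"
  obtains m t where "is_grid n (m, t)" "y < lower_sum n g (m, t)"
proof -
  have "\<exists>z\<in>lower_sum n g ` Collect (is_grid n). y < z"
    by (rule less_cSupD[OF _ assms[unfolded lower_integral_def]]) (use is_grid_ex[of n] in blast)
  then obtain P where "is_grid n P" "y < lower_sum n g P" by auto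
  then show ?thesis using that[of "fst P" "snd P"] by simp
qed

text \<open>Take a grid whose upper sum is close to the integral, with the cell suprema as
  coefficients. They dominate \<open>H\<close> on the half-open cells, which lie inside the closed
  ones.\<close>

lemma riemann_open_cube_grid_upper:
  assumes "riemann_integrable_open_cube n H" "e > 0"
  obtains P c where "is_grid n P" "\<And>z. z \<in> open_cube n \<Longrightarrow> H z \<le> grid_step n P c z"
    "grid_step_integral n P c < upper_integral n (\<lambda>z. if z \<in> open_cube n then H z else 0) + e"
proof -
  define H0 where "H0 z = (if z \<in> open_cube n then H z else 0)" for z
  have b: "bounded (H0 ` closed_cube n)"
    using assms(1) by (simp add: riemann_integrable_open_cube_def riemann_integrable_cube_def H0_def[abs_def])
  have "upper_integral n H0 < upper_integral n H0 + e" using assms(2) by simp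
  then obtain m t where mt: "is_grid n (m, t)" "upper_sum n H0 (m, t) < upper_integral n H0 + e" by (rule upper_integral_lessD)
  define c where "c J = (SUP z\<in>grid_cell n t J. H0 z)" for J
  show ?thesis
  proof (rule that[OF mt(1)])
    fix z assume z: "z \<in> open_cube n"
    then obtain J where J: "J \<in> (\<Pi>\<^sub>E i\<in>{1..n}. {..<m i})"
      "\<And>i. i \<in> {1..n} \<Longrightarrow> z i \<in> {t i (J i)<..t i (Suc (J i))}"
      "\<And>c. grid_step n (m, t) c z = c J"
      using grid_step_eq[OF mt(1), of z] by (auto simp: open_cube_def PiE_iff less_imp_le)
    have "z \<in> grid_cell n t J"
      using J(2) z by (auto simp: grid_cell_def open_cube_def PiE_iff less_imp_le)
    moreover have "bdd_above (H0 ` grid_cell n t J)"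
      by (rule bdd_above_mono[OF bounded_imp_bdd_above[OF b] image_mono[OF grid_cell_subset_closed_cube[OF mt(1) J(1)]]])
    ultimately have "H0 z \<le> c J" unfolding c_def by (rule cSUP_upper)
    then show "H z \<le> grid_step n (m, t) c z" using z by (simp add: J(3) H0_def)
  next
    show "grid_step_integral n (m, t) c < upper_integral n (\<lambda>z. if z \<in> open_cube n then H z else 0) + e"
      using mt(2) by (simp add: upper_sum_def grid_step_integral_def c_def H0_def[abs_def] mult.commute)
  qed
qed

text \<open>By integrability the lower integral equals the upper one, so the bound can refer to the
  same number as the approximation from above.\<close>

lemma riemann_open_cube_grid_lower:
  assumes "riemann_integrable_open_cube n H" "e > 0"
  obtains P c where "is_grid n P" "\<And>z. z \<in> open_cube n \<Longrightarrow> grid_step n P c z \<le> H z"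
    "upper_integral n (\<lambda>z. if z \<in> open_cube n then H z else 0) - e < grid_step_integral n P c"
proof -
  define H0 where "H0 z = (if z \<in> open_cube n then H z else 0)" for z
  have b: "bounded (H0 ` closed_cube n)" and eq: "lower_integral n H0 = upper_integral n H0"
    using assms(1) by (simp_all add: riemann_integrable_open_cube_def riemann_integrable_cube_def H0_def[abs_def])
  have "upper_integral n H0 - e < lower_integral n H0" using assms(2) eq by simp
  then obtain m t where mt: "is_grid n (m, t)" "upper_integral n H0 - e < lower_sum n H0 (m, t)" by (rule less_lower_integralD)
  define c where "c J = (INF z\<in>grid_cell n t J. H0 z)" for J
  show ?thesis
  proof (rule that[OF mt(1)])
    fix z assume z: "z \<in> open_cube n"
    then obtain J where J: "J \<in> (\<Pi>\<^sub>E i\<in>{1..n}. {..<m i})"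
      "\<And>i. i \<in> {1..n} \<Longrightarrow> z i \<in> {t i (J i)<..t i (Suc (J i))}"
      "\<And>c. grid_step n (m, t) c z = c J"
      using grid_step_eq[OF mt(1), of z] by (auto simp: open_cube_def PiE_iff less_imp_le)
    have "z \<in> grid_cell n t J"
      using J(2) z by (auto simp: grid_cell_def open_cube_def PiE_iff less_imp_le)
    moreover have "bdd_below (H0 ` grid_cell n t J)"
      by (rule bdd_below_mono[OF bounded_imp_bdd_below[OF b] image_mono[OF grid_cell_subset_closed_cube[OF mt(1) J(1)]]])
    ultimately have "c J \<le> H0 z" unfolding c_def by (intro cINF_lower)
    then show "grid_step n (m, t) c z \<le> H z" using z by (simp add: J(3) H0_def)
  next
    show "upper_integral n (\<lambda>z. if z \<in> open_cube n then H z else 0) - e < grid_step_integral n (m, t) c"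
      using mt(2) by (simp add: lower_sum_def grid_step_integral_def c_def H0_def[abs_def] mult.commute)
  qed
qed

text \<open>A positive lower sum has a cell on which the infimum of the indicator is positive; that
  whole cell lies in \<open>C\<close>.\<close>

lemma jordan_measure_pos_contains_box:
  assumes "jordan_measurable n C" "jordan_measure n C > 0"
  obtains a b where "\<And>r. r \<in> {1..n} \<Longrightarrow> 0 \<le> a r \<and> a r < b r \<and> b r \<le> (1::real)"
    "(\<Pi>\<^sub>E r\<in>{1..n}. {a r<..b r}) \<subseteq> C"
proof -
  have "lower_integral n (indicator C) > 0"
    using assms by (simp add: jordan_measurable_def jordan_measure_def riemann_integrable_cube_def)
  then obtain m t where mt: "is_grid n (m, t)" "lower_sum n (indicator C) (m, t) > 0" by (rule less_lower_integralD)
  from mt(2) obtain J where J: "J \<in> (\<Pi>\<^sub>E i\<in>{1..n}. {..<m i})"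
    "cell_volume n t J * (INF z\<in>grid_cell n t J. indicator C z) > 0"
    unfolding lower_sum_def split_conv by (meson not_le sum_nonpos)
  have "cell_volume n t J \<ge> 0"
    unfolding cell_volume_def using is_grid_interval(2)[OF mt(1) J(1)] by (auto intro!: prod_nonneg simp: less_imp_le)
  with J(2) have inf: "(INF z\<in>grid_cell n t J. indicator C z) > (0::real)"
    by (auto simp: zero_less_mult_iff)
  show ?thesis
  proof (rule that[of "\<lambda>i. t i (J i)" "\<lambda>i. t i (Suc (J i))"])
    fix r assume "r \<in> {1..n}"
    from is_grid_interval[OF mt(1) J(1) this]
    show "0 \<le> t r (J r) \<and> t r (J r) < t r (Suc (J r)) \<and> t r (Suc (J r)) \<le> 1" by simp
  next
    show "(\<Pi>\<^sub>E r\<in>{1..n}. {t r (J r)<..t r (Suc (J r))}) \<subseteq> C"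
    proof
      fix u assume u: "u \<in> (\<Pi>\<^sub>E r\<in>{1..n}. {t r (J r)<..t r (Suc (J r))})"
      then have "u \<in> grid_cell n t J" by (auto simp: grid_cell_def PiE_iff less_imp_le)
      then have "(INF z\<in>grid_cell n t J. indicator C z) \<le> (indicator C u :: real)"
        by (intro cINF_lower bdd_belowI2[where m = 0]) auto
      with inf have "(indicator C u :: real) > 0" by linarith
      then show "u \<in> C" by (simp add: indicator_def split: if_splits)
    qed
  qed
qed

section \<open>The transition operator and its contraction\<close>

lemma driven_chain_cong:
  "(\<And>k. k \<in> {1..m} \<Longrightarrow> U k = U' k) \<Longrightarrow> driven_chain F x U m = driven_chain F x U' m"
  by (induction m) auto

lemma driven_chain_add:
  "driven_chain F x U (l + k) = driven_chain F (driven_chain F x U l) (\<lambda>k. U (l + k)) k"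
  by (induction k) auto

lemma driven_chain_in:
  assumes "\<And>y k. y \<in> S \<Longrightarrow> k \<ge> 1 \<Longrightarrow> F y (U k) \<in> S" "x \<in> S"
  shows "driven_chain F x U m \<in> S"
  using assms by (induction m) auto

text \<open>After step \<open>k\<close> both chains are in the same state, and from then on they use
  the same seeds.\<close>

lemma driven_chain_coupled:
  assumes S: "\<And>y k. y \<in> S \<Longrightarrow> k \<ge> 1 \<Longrightarrow> F y (U k) \<in> S" "x \<in> S" "x' \<in> S"
    and k: "k \<in> {1..m}" "\<And>y y'. y \<in> S \<Longrightarrow> y' \<in> S \<Longrightarrow> F y (U k) = F y' (U k)"
  shows "driven_chain F x U m = driven_chain F x' U m"
proof -
  obtain j where j: "k = Suc j" using k(1) by (cases k) auto
  have "driven_chain F x U j \<in> S" "driven_chain F x' U j \<in> S"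
    by (rule driven_chain_in[where S = S]; use S in auto)+
  then have "F (driven_chain F x U j) (U k) = F (driven_chain F x' U j) (U k)" by (rule k(2))
  then have "driven_chain F x U k = driven_chain F x' U k" by (simp only: j driven_chain.simps)
  then show ?thesis
    using k(1) driven_chain_add[of F x U k "m - k"] driven_chain_add[of F x' U k "m - k"] by simp
qed

section \<open>Iterates of the transition operator and expectations along the chain\<close>

definition markov_op :: "'u measure \<Rightarrow> ('a \<Rightarrow> 'u \<Rightarrow> 'a) \<Rightarrow> ('a \<Rightarrow> real) \<Rightarrow> 'a \<Rightarrow> real" where
  "markov_op R F h x = (\<integral>u. h (F x u) \<partial>R)"

lemma markov_update_space:
  "markov_update S R F \<Longrightarrow> x \<in> space S \<Longrightarrow> u \<in> space R \<Longrightarrow> F x u \<in> space S"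
  using measurable_space[of "\<lambda>(x, u). F x u" "S \<Otimes>\<^sub>M R" S "(x, u)"]
  by (auto simp: markov_update_def space_pair_measure)

lemma markov_update_integrable:
  fixes h :: "'a \<Rightarrow> real"
  assumes "markov_update S R F" "h \<in> borel_measurable S" "\<And>x. x \<in> space S \<Longrightarrow> \<bar>h x\<bar> \<le> B" "x \<in> space S"
  shows "integrable R (\<lambda>u. h (F x u))"
proof -
  interpret prob_space R using assms(1) by (simp add: markov_update_def)
  have "(\<lambda>u. (\<lambda>(x, u). F x u) (x, u)) \<in> R \<rightarrow>\<^sub>M S"
    using assms(1,4) by (intro measurable_compose[OF measurable_Pair1']) (auto simp: markov_update_def)
  then have "(\<lambda>u. h (F x u)) \<in> borel_measurable R"
    using assms(2) by (auto intro: measurable_compose)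
  then show ?thesis
    by (rule integrable_const_bound[where B = B, rotated])
       (use markov_update_space[OF assms(1,4)] assms(3) in auto)
qed

lemma markov_op_bound:
  assumes "markov_update S R F" "h \<in> borel_measurable S" "\<And>x. x \<in> space S \<Longrightarrow> \<bar>h x\<bar> \<le> B" "x \<in> space S"
  shows "\<bar>markov_op R F h x\<bar> \<le> B"
proof -
  interpret prob_space R using assms(1) by (simp add: markov_update_def)
  have i: "integrable R (\<lambda>u. h (F x u))" by (rule markov_update_integrable[OF assms])
  have "\<bar>markov_op R F h x\<bar> \<le> (\<integral>u. \<bar>h (F x u)\<bar> \<partial>R)"
    unfolding markov_op_def by (rule integral_abs_bound)
  also have "\<dots> \<le> (\<integral>u. B \<partial>R)"
    by (intro integral_mono integrable_abs i) (use assms(3) markov_update_space[OF assms(1,4)] in auto)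
  finally show ?thesis by (simp add: prob_space)
qed

lemma markov_op_measurable:
  assumes "markov_update S R F" "h \<in> borel_measurable S"
  shows "markov_op R F h \<in> borel_measurable S"
proof -
  interpret prob_space R using assms(1) by (simp add: markov_update_def)
  have "(\<lambda>(x, u). h (F x u)) \<in> borel_measurable (S \<Otimes>\<^sub>M R)"
    using measurable_compose[OF _ assms(2), of "\<lambda>(x, u). F x u" "S \<Otimes>\<^sub>M R"] assms(1)
    unfolding markov_update_def case_prod_beta' by blast
  then show ?thesis unfolding markov_op_def[abs_def]
    by (rule borel_measurable_lebesgue_integral)
qed

lemma funpow_markov_op:
  assumes "markov_update S R F" "h \<in> borel_measurable S" "\<And>x. x \<in> space S \<Longrightarrow> \<bar>h x\<bar> \<le> B"
  shows "(markov_op R F ^^ m) h \<in> borel_measurable S"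
    "\<And>x. x \<in> space S \<Longrightarrow> \<bar>(markov_op R F ^^ m) h x\<bar> \<le> B"
proof (induction m)
  case (Suc m)
  { case 1 show ?case using markov_op_measurable[OF assms(1) Suc(1)] by simp }
  { case 2 then show ?case using markov_op_bound[OF assms(1) Suc(1) Suc(2)] by simp }
qed (use assms in auto)

text \<open>The product keeps its \<open>n\<close> factors while \<open>m\<close> grows, so that
  every step of the induction takes place on the same space.\<close>

lemma measurable_driven_chain:
  assumes "markov_update S R F" "x \<in> space S" "m \<le> n"
  shows "(\<lambda>U. driven_chain F x U m) \<in> (\<Pi>\<^sub>M k\<in>{1..n}. R) \<rightarrow>\<^sub>M S"
  using assms(3)
proof (induction m)
  case 0
  then show ?case using assms(2) by simp
next
  case (Suc m)
  have "(\<lambda>U. (driven_chain F x U m, U (Suc m))) \<in> (\<Pi>\<^sub>M k\<in>{1..n}. R) \<rightarrow>\<^sub>M S \<Otimes>\<^sub>M R"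
    using Suc by (intro measurable_Pair measurable_component_singleton) auto
  from measurable_compose[OF this, of "\<lambda>(x, u). F x u" S] show ?case
    using assms(1) by (simp add: markov_update_def)
qed

text \<open>Fubini integrates out the last seed first, which replaces \<open>h\<close> by its image
  under the operator; the induction therefore runs over all bounded measurable
  \<open>h\<close>.\<close>

lemma integral_driven_chain:
  assumes mu: "markov_update S R F" and "x \<in> space S"
    and "h \<in> borel_measurable S" "\<And>x. x \<in> space S \<Longrightarrow> \<bar>h x\<bar> \<le> B"
  shows "(\<integral>U. h (driven_chain F x U m) \<partial>(\<Pi>\<^sub>M k\<in>{1..m}. R)) = (markov_op R F ^^ m) h x"
  using assms(3,4)
proof (induction m arbitrary: h)
  case 0
  show ?case
    by (simp add: PiM_empty lebesgue_integral_count_space_finite)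
next
  case (Suc m)
  interpret R: prob_space R using mu by (simp add: markov_update_def)
  interpret product_sigma_finite "\<lambda>_::nat. R" by standard
  interpret P: prob_space "\<Pi>\<^sub>M k\<in>{1..Suc m}. R" by (rule prob_space_PiM) (rule R.prob_space_axioms)
  have ins: "{1..Suc m} = insert (Suc m) {1..m}" by auto
  have meas: "(\<lambda>U. h (driven_chain F x U (Suc m))) \<in> borel_measurable (\<Pi>\<^sub>M k\<in>{1..Suc m}. R)"
    using measurable_compose[OF measurable_driven_chain[OF mu assms(2), of "Suc m" "Suc m"] Suc.prems(1)] by blast
  have int: "integrable (\<Pi>\<^sub>M k\<in>insert (Suc m) {1..m}. R) (\<lambda>U. h (driven_chain F x U (Suc m)))"
    unfolding ins[symmetric]
    by (rule P.integrable_const_bound[where B = B, OF _ meas])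
       (use Suc.prems(2) measurable_space[OF measurable_driven_chain[OF mu assms(2), of "Suc m" "Suc m"]] in auto)
  have "(\<integral>U. h (driven_chain F x U (Suc m)) \<partial>(\<Pi>\<^sub>M k\<in>{1..Suc m}. R))
      = (\<integral>U. (\<integral>u. h (driven_chain F x (U(Suc m := u)) (Suc m)) \<partial>R) \<partial>(\<Pi>\<^sub>M k\<in>{1..m}. R))"
    unfolding ins by (rule product_integral_insert) (use int in auto)
  also have "\<dots> = (\<integral>U. markov_op R F h (driven_chain F x U m) \<partial>(\<Pi>\<^sub>M k\<in>{1..m}. R))"
  proof -
    have "driven_chain F x (U(Suc m := u)) m = driven_chain F x U m" for U u
      by (rule driven_chain_cong) auto
    then show ?thesis by (simp add: markov_op_def)
  qed
  also have "\<dots> = (markov_op R F ^^ m) (markov_op R F h) x"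
    using markov_op_measurable[OF mu Suc.prems(1)] markov_op_bound[OF mu Suc.prems] by (rule Suc.IH)
  finally show ?case by (simp add: funpow_swap1)
qed

text \<open>Both states are moved by the same seed: the difference vanishes on \<open>A\<close> and
  is at most \<open>e\<close> elsewhere.\<close>

lemma markov_op_osc:
  assumes mu: "markov_update S R F" and "h \<in> borel_measurable S" "\<And>x. x \<in> space S \<Longrightarrow> \<bar>h x\<bar> \<le> B"
    and A: "A \<in> sets R" "\<And>u x x'. u \<in> A \<Longrightarrow> x \<in> space S \<Longrightarrow> x' \<in> space S \<Longrightarrow> F x u = F x' u"
    and osc: "\<And>x x'. x \<in> space S \<Longrightarrow> x' \<in> space S \<Longrightarrow> \<bar>h x - h x'\<bar> \<le> e"
    and x: "x \<in> space S" "x' \<in> space S"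
  shows "\<bar>markov_op R F h x - markov_op R F h x'\<bar> \<le> (1 - measure R A) * e"
proof -
  interpret prob_space R using mu by (simp add: markov_update_def)
  note int = markov_update_integrable[OF assms(1-3)]
  have "\<bar>markov_op R F h x - markov_op R F h x'\<bar> = \<bar>\<integral>u. h (F x u) - h (F x' u) \<partial>R\<bar>"
    by (simp add: markov_op_def int x)
  also have "\<dots> \<le> (\<integral>u. \<bar>h (F x u) - h (F x' u)\<bar> \<partial>R)" by (rule integral_abs_bound)
  also have "\<dots> \<le> (\<integral>u. indicator (space R - A) u * e \<partial>R)"
  proof (rule integral_mono)
    show "integrable R (\<lambda>u. \<bar>h (F x u) - h (F x' u)\<bar>)" using int x by simp
    show "integrable R (\<lambda>u. indicator (space R - A) u * e)"
      using A(1) by (intro integrable_mult_left integrable_real_indicator) (auto simp: emeasure_eq_measure)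
    fix u assume "u \<in> space R"
    then show "\<bar>h (F x u) - h (F x' u)\<bar> \<le> indicator (space R - A) u * e"
      using A(2)[of u x x'] osc markov_update_space[OF mu] x by (auto simp: indicator_def)
  qed
  also have "\<dots> = (1 - measure R A) * e" using A(1) by (simp add: prob_compl)
  finally show ?thesis .
qed

text \<open>Invariance says that \<open>F\<close> maps the product of \<open>D\<close> and
  \<open>R\<close> to \<open>D\<close>. Change of variables and Fubini then carry it from sets to
  bounded functions.\<close>

lemma integral_invariant:
  assumes mu: "markov_update S R F" and inv: "invariant_distribution S R F D"
    and h: "h \<in> borel_measurable S" "\<And>x. x \<in> space S \<Longrightarrow> \<bar>h x\<bar> \<le> B"
  shows "(\<integral>x. markov_op R F h x \<partial>D) = (\<integral>x. h x \<partial>D)"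
proof -
  interpret R: prob_space R using mu by (simp add: markov_update_def)
  interpret D: prob_space D using inv by (simp add: invariant_distribution_def)
  interpret pair_prob_space D R ..
  have D[measurable_cong]: "sets D = sets S" using inv by (simp add: invariant_distribution_def)
  have F[measurable]: "(\<lambda>(x, u). F x u) \<in> D \<Otimes>\<^sub>M R \<rightarrow>\<^sub>M S"
    using mu by (simp add: markov_update_def measurable_cong_sets[OF sets_pair_measure_cong[OF D refl] refl])
  have eq: "distr (D \<Otimes>\<^sub>M R) S (\<lambda>(x, u). F x u) = D"
  proof (rule measure_eqI)
    fix A assume "A \<in> sets (distr (D \<Otimes>\<^sub>M R) S (\<lambda>(x, u). F x u))"
    then have A: "A \<in> sets S" by simp
    have "emeasure (distr (D \<Otimes>\<^sub>M R) S (\<lambda>(x, u). F x u)) A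
        = (\<integral>\<^sup>+x. emeasure R (Pair x -` ((\<lambda>(x, u). F x u) -` A \<inter> space (D \<Otimes>\<^sub>M R))) \<partial>D)"
      using A measurable_sets[OF F A] by (simp add: emeasure_distr[OF F] R.emeasure_pair_measure_alt)
    also have "\<dots> = (\<integral>\<^sup>+x. emeasure (distr R S (F x)) A \<partial>D)"
    proof (rule nn_integral_cong)
      fix x assume x: "x \<in> space D"
      have "F x \<in> R \<rightarrow>\<^sub>M S" using measurable_compose[OF measurable_Pair1'[OF x] F] by simp
      then show "emeasure R (Pair x -` ((\<lambda>(x, u). F x u) -` A \<inter> space (D \<Otimes>\<^sub>M R))) = emeasure (distr R S (F x)) A"
        using x A by (auto simp: emeasure_distr space_pair_measure intro!: arg_cong[where f = "emeasure R"])
    qed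
    also have "\<dots> = emeasure D A" using inv A by (simp add: invariant_distribution_def)
    finally show "emeasure (distr (D \<Otimes>\<^sub>M R) S (\<lambda>(x, u). F x u)) A = emeasure D A" .
  qed (simp add: D)
  have hF: "(\<lambda>(x, u). h (F x u)) \<in> borel_measurable (D \<Otimes>\<^sub>M R)"
    using measurable_compose[OF F h(1)] by (simp add: case_prod_beta')
  have "integrable (D \<Otimes>\<^sub>M R) (\<lambda>(x, u). h (F x u))"
    by (rule P.integrable_const_bound[where B = B, OF _ hF])
       (use h(2) measurable_space[OF F] in \<open>auto simp: space_pair_measure\<close>)
  from integral_fst'[OF this]
  have "(\<integral>x. markov_op R F h x \<partial>D) = (\<integral>z. (\<lambda>(x, u). h (F x u)) z \<partial>(D \<Otimes>\<^sub>M R))"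
    by (simp add: markov_op_def)
  also have "\<dots> = (\<integral>x. h x \<partial>distr (D \<Otimes>\<^sub>M R) S (\<lambda>(x, u). F x u))"
    using integral_distr[OF F h(1)] by (simp add: case_prod_beta')
  finally show ?thesis by (simp add: eq)
qed

text \<open>A coupling set of measure \<open>p\<close> contracts the oscillation by \<open>1 - p\<close> at each step.\<close>

lemma funpow_markov_op_invariant:
  assumes mu: "markov_update S R F" and inv: "invariant_distribution S R F D"
    and h: "h \<in> borel_measurable S" "\<And>x. x \<in> space S \<Longrightarrow> \<bar>h x\<bar> \<le> B"
    and A: "A \<in> sets R" "\<And>u x x'. u \<in> A \<Longrightarrow> x \<in> space S \<Longrightarrow> x' \<in> space S \<Longrightarrow> F x u = F x' u"
    and x: "x \<in> space S"
  shows "\<bar>(markov_op R F ^^ m) h x - (\<integral>y. h y \<partial>D)\<bar> \<le> (1 - measure R A) ^ m * (2 * B)"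
proof -
  interpret D: prob_space D using inv by (simp add: invariant_distribution_def)
  have D[measurable_cong]: "sets D = sets S" using inv by (simp add: invariant_distribution_def)
  have sD: "space D = space S" using D by (rule sets_eq_imp_space_eq)
  note it = funpow_markov_op[OF mu h]
  have osc: "\<bar>(markov_op R F ^^ m) h x - (markov_op R F ^^ m) h y\<bar> \<le> (1 - measure R A) ^ m * (2 * B)"
    if "x \<in> space S" "y \<in> space S" for x y
    using that
  proof (induction m arbitrary: x y)
    case 0
    then show ?case using h(2)[of x] h(2)[of y] by (simp add: abs_le_iff)
  next
    case (Suc m)
    from markov_op_osc[OF mu it A Suc.IH Suc.prems] show ?case by (simp add: mult.assoc)
  qed
  have "(\<integral>y. (markov_op R F ^^ m) h y \<partial>D) = (\<integral>y. h y \<partial>D)"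
  proof (induction m)
    case (Suc m)
    then show ?case using integral_invariant[OF mu inv it] by simp
  qed simp
  moreover have "integrable D ((markov_op R F ^^ m) h)"
    by (rule D.integrable_const_bound[where B = B]) (use it sD in \<open>auto simp: measurable_cong_sets[OF D refl]\<close>)
  \<comment> \<open>By invariance the deviation is the mean over \<open>y\<close> of the differences
    between \<open>x\<close> and \<open>y\<close>, each bounded by the oscillation.\<close>
  ultimately have "(markov_op R F ^^ m) h x - (\<integral>y. h y \<partial>D)
      = (\<integral>y. (markov_op R F ^^ m) h x - (markov_op R F ^^ m) h y \<partial>D)"
    and int: "integrable D (\<lambda>y. (markov_op R F ^^ m) h x - (markov_op R F ^^ m) h y)"
    by (simp_all add: D.prob_space)
  then have "\<bar>(markov_op R F ^^ m) h x - (\<integral>y. h y \<partial>D)\<bar>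
      \<le> (\<integral>y. \<bar>(markov_op R F ^^ m) h x - (markov_op R F ^^ m) h y\<bar> \<partial>D)"
    by (simp only: integral_abs_bound)
  also have "\<dots> \<le> (\<integral>y. (1 - measure R A) ^ m * (2 * B) \<partial>D)"
    by (intro integral_mono integrable_abs int) (use osc x sD in auto)
  finally show ?thesis by (simp add: D.prob_space)
qed

section \<open>Uniform measure on blocks\<close>

lemma prob_space_unit_interval: "prob_space (restrict_space lborel {0<..<1::real})"
  by (rule prob_spaceI) (simp add: emeasure_restrict_space space_restrict_space)

lemma unit_interval_indicator:
  assumes "0 \<le> a" "a \<le> b" "b \<le> (1::real)"
  shows "integrable (restrict_space lborel {0<..<1::real}) (indicator {a<..b} :: real \<Rightarrow> real)"
    "(\<integral>t. indicator {a<..b} t \<partial>restrict_space lborel {0<..<1::real}) = b - a"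
proof -
  interpret prob_space "restrict_space lborel {0<..<1::real}" by (rule prob_space_unit_interval)
  have s: "{a<..b} \<inter> {0<..<1} \<in> sets (restrict_space lborel {0<..<1::real})"
    by (auto simp: sets_restrict_space)
  have "integrable (restrict_space lborel {0<..<1::real}) (indicator ({a<..b} \<inter> {0<..<1}) :: real \<Rightarrow> real)"
    by (rule integrable_real_indicator[OF s]) (simp add: emeasure_eq_measure)
  then show "integrable (restrict_space lborel {0<..<1::real}) (indicator {a<..b} :: real \<Rightarrow> real)"
    by (rule Bochner_Integration.integrable_cong[THEN iffD1, rotated 2])
       (auto simp: space_restrict_space indicator_def)
  have "(\<integral>t. indicator {a<..b} t \<partial>restrict_space lborel {0<..<1::real})
      = (\<integral>t. indicator ({a<..b} \<inter> {0<..<1}) t \<partial>restrict_space lborel {0<..<1::real})"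
    by (intro Bochner_Integration.integral_cong) (auto simp: space_restrict_space indicator_def)
  also have "\<dots> = measure (restrict_space lborel {0<..<1::real}) ({a<..b} \<inter> {0<..<1})"
    using s by simp
  also have "\<dots> = measure lborel ({a<..b} \<inter> {0<..<1})"
    by (rule measure_restrict_space) auto
  \<comment> \<open>The open unit interval cuts off at most the endpoint \<open>b = 1\<close>, a
    null set.\<close>
  also have "{a<..b} \<inter> {0<..<1} = (if b < 1 then {a<..b} else {a<..<b})" using assms by auto
  also have "measure lborel \<dots> = b - a" using assms by simp
  finally show "(\<integral>t. indicator {a<..b} t \<partial>restrict_space lborel {0<..<1::real}) = b - a" .
qed

lemma prob_space_uniform_cube: "prob_space (uniform_cube n)"
  unfolding uniform_cube_def by (intro prob_space_PiM prob_space_unit_interval)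

lemma space_uniform_cube: "space (uniform_cube n) = open_cube n"
  by (simp add: uniform_cube_def open_cube_def space_PiM space_restrict_space)

lemma uniform_cube_box:
  assumes "\<And>r. r \<in> {1..n} \<Longrightarrow> 0 \<le> a r \<and> a r \<le> b r \<and> b r \<le> (1::real)"
  shows "integrable (uniform_cube n) (\<lambda>u. \<Prod>r=1..n. indicator {a r<..b r} (u r) :: real)"
    "(\<integral>u. (\<Prod>r=1..n. indicator {a r<..b r} (u r)) \<partial>uniform_cube n) = (\<Prod>r=1..n. b r - a r)"
proof -
  interpret p: prob_space "restrict_space lborel {0<..<1::real}" by (rule prob_space_unit_interval)
  interpret product_sigma_finite "\<lambda>_::nat. restrict_space lborel {0<..<1::real}" by standard
  show "integrable (uniform_cube n) (\<lambda>u. \<Prod>r=1..n. indicator {a r<..b r} (u r) :: real)"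
    unfolding uniform_cube_def
    by (rule product_integrable_prod) (use assms unit_interval_indicator(1) in auto)
  have "(\<integral>u. (\<Prod>r=1..n. indicator {a r<..b r} (u r) :: real) \<partial>uniform_cube n)
     = (\<Prod>r=1..n. \<integral>t. indicator {a r<..b r} t \<partial>restrict_space lborel {0<..<1::real})"
    unfolding uniform_cube_def
    by (rule product_integral_prod) (use assms unit_interval_indicator(1) in auto)
  also have "\<dots> = (\<Prod>r=1..n. b r - a r)"
    by (intro prod.cong refl unit_interval_indicator(2)) (use assms in auto)
  finally show "(\<integral>u. (\<Prod>r=1..n. indicator {a r<..b r} (u r)) \<partial>uniform_cube n) = (\<Prod>r=1..n. b r - a r)" .
qed

lemma measure_uniform_cube_box:
  assumes "\<And>r. r \<in> {1..n} \<Longrightarrow> 0 \<le> a r \<and> a r \<le> b r \<and> b r \<le> (1::real)"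
  defines "A \<equiv> (\<Pi>\<^sub>E r\<in>{1..n}. {a r<..b r}) \<inter> open_cube n"
  shows "A \<in> sets (uniform_cube n)" "measure (uniform_cube n) A = (\<Prod>r=1..n. b r - a r)"
proof -
  have "A = (\<Pi>\<^sub>E r\<in>{1..n}. {a r<..b r} \<inter> {0<..<1})"
    by (auto simp: A_def open_cube_def PiE_iff)
  then show A: "A \<in> sets (uniform_cube n)"
    unfolding uniform_cube_def by (auto intro!: sets_PiM_I_finite simp: sets_restrict_space_iff)
  interpret prob_space "uniform_cube n" by (rule prob_space_uniform_cube)
  have "measure (uniform_cube n) A = (\<integral>u. indicator A u \<partial>uniform_cube n)" using A by simp
  also have "\<dots> = (\<integral>u. (\<Prod>r=1..n. indicator {a r<..b r} (u r)) \<partial>uniform_cube n)"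
  proof (intro Bochner_Integration.integral_cong refl)
    fix u assume "u \<in> space (uniform_cube n)"
    then have u: "u \<in> open_cube n" by (simp add: space_uniform_cube)
    then have "indicator A u = (indicator (\<Pi>\<^sub>E r\<in>{1..n}. {a r<..b r}) u :: real)"
      by (simp add: A_def indicator_def)
    also have "\<dots> = (\<Prod>r=1..n. indicator {a r<..b r} (u r))"
      by (rule indicator_box_eq) (use u in \<open>auto simp: open_cube_def PiE_iff\<close>)
    finally show "indicator A u = (\<Prod>r=1..n. indicator {a r<..b r} (u r) :: real)" .
  qed
  also have "\<dots> = (\<Prod>r=1..n. b r - a r)" by (rule uniform_cube_box(2)) (use assms in auto)
  finally show "measure (uniform_cube n) A = (\<Prod>r=1..n. b r - a r)" .
qed

text \<open>Undoes the cutting into blocks; as coordinates count from 1, \<open>div\<close> and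
  \<open>mod\<close> act on \<open>r - 1\<close>. It carries statements about one long vector, such
  as regularity, to the product space of the seeds.\<close>

definition concat_blocks :: "nat \<Rightarrow> nat \<Rightarrow> (nat \<Rightarrow> nat \<Rightarrow> real) \<Rightarrow> nat \<Rightarrow> real" where
  "concat_blocks s m U = (\<lambda>r\<in>{1..m * s}. U (Suc ((r - 1) div s)) (Suc ((r - 1) mod s)))"

lemma concat_blocks_apply:
  assumes "k < m" "r < s"
  shows "concat_blocks s m U (Suc (k * s + r)) = U (Suc k) (Suc r)"
proof -
  have "k * s + r < Suc k * s" using assms by simp
  also have "\<dots> \<le> m * s" using assms by (intro mult_le_mono1) simp
  finally show ?thesis using assms by (simp add: concat_blocks_def)
qed

lemma block_concat_blocks:
  assumes "U k \<in> extensional {1..s}" "k \<in> {1..m}"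
  shows "block s (concat_blocks s m U) (k - 1) = U k"
proof
  fix r
  show "block s (concat_blocks s m U) (k - 1) r = U k r"
  proof (cases "r \<in> {1..s}")
    case True
    then show ?thesis
      using concat_blocks_apply[of "k - 1" m "r - 1" s U] assms(2) by (auto simp: block_def)
  next
    case False
    then show ?thesis using assms(1) by (auto simp: block_def extensional_def)
  qed
qed

lemma concat_blocks_open_cube:
  assumes "s \<ge> 1" "\<And>k. k \<in> {1..m} \<Longrightarrow> U k \<in> open_cube s"
  shows "concat_blocks s m U \<in> open_cube (m * s)"
proof -
  have "U (Suc ((r - 1) div s)) (Suc ((r - 1) mod s)) \<in> {0<..<1}" if "r \<in> {1..m * s}" for r
  proof -
    have "r - 1 < m * s" using that by auto
    then have "(r - 1) div s < m" by (simp add: less_mult_imp_div_less)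
    moreover have "(r - 1) mod s < s" using assms(1) by simp
    ultimately show ?thesis using assms(2)[of "Suc ((r - 1) div s)"] by (auto simp: open_cube_def PiE_iff)
  qed
  then show ?thesis unfolding open_cube_def concat_blocks_def by auto
qed

lemma prod_blocks:
  fixes g :: "nat \<Rightarrow> 'a::comm_monoid_mult"
  shows "(\<Prod>i=1..m * s. g i) = (\<Prod>k=1..m. \<Prod>r=1..s. g (Suc ((k - 1) * s + (r - 1))))"
proof -
  have "(\<Prod>i=1..m * s. g i) = (\<Prod>i<m * s. g (Suc i))"
    by (simp add: prod.atLeast1_atMost_eq)
  also have "\<dots> = (\<Prod>k<m. \<Prod>i=k * s..<k * s + s. g (Suc i))"
    by (rule prod.nat_group[symmetric])
  also have "\<dots> = (\<Prod>k<m. \<Prod>r<s. g (Suc (k * s + r)))"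
  proof (rule prod.cong[OF refl])
    fix k show "(\<Prod>i=k * s..<k * s + s. g (Suc i)) = (\<Prod>r<s. g (Suc (k * s + r)))"
      using prod.shift_bounds_nat_ivl[of "\<lambda>i. g (Suc i)" 0 "k * s" s] by (simp add: atLeast0LessThan add.commute)
  qed
  finally show ?thesis by (simp add: prod.atLeast1_atMost_eq)
qed

text \<open>The indicator of a cell is a product over coordinates, hence over blocks, and the seeds
  are independent; its integral is therefore the cell volume.\<close>

lemma integral_grid_step:
  assumes g: "is_grid (n * s) P" and s: "s \<ge> 1"
  defines "Q \<equiv> \<Pi>\<^sub>M k\<in>{1..n}. uniform_cube s"
  shows "integrable Q (\<lambda>U. grid_step (n * s) P c (concat_blocks s n U))"
    "(\<integral>U. grid_step (n * s) P c (concat_blocks s n U) \<partial>Q) = grid_step_integral (n * s) P c"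
proof -
  obtain m t where P: "P = (m, t)" by (cases P)
  interpret p: prob_space "uniform_cube s" by (rule prob_space_uniform_cube)
  interpret product_sigma_finite "\<lambda>_::nat. uniform_cube s" by standard
  let ?J = "\<Pi>\<^sub>E i\<in>{1..n * s}. {..<m i}"
  \<comment> \<open>The position in the long vector of coordinate \<open>r\<close> of block
    \<open>k\<close>.\<close>
  define ix where "ix k r = Suc ((k - 1) * s + (r - 1))" for k r
  define fac where "fac J k u = (\<Prod>r=1..s. indicator {t (ix k r) (J (ix k r))<..t (ix k r) (Suc (J (ix k r)))} (u r) :: real)"
    for J :: "nat \<Rightarrow> nat" and k and u :: "nat \<Rightarrow> real"
  have ix: "ix k r \<in> {1..n * s}" if "k \<in> {1..n}" "r \<in> {1..s}" for k r
  proof -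
    have "(k - 1) * s + (r - 1) < (k - 1) * s + s" using that by auto
    also have "\<dots> = k * s" using that by (cases k) auto
    also have "\<dots> \<le> n * s" using that by simp
    finally show ?thesis by (simp add: ix_def)
  qed
  have eq: "(\<Prod>i=1..n * s. indicator {t i (J i)<..t i (Suc (J i))} (concat_blocks s n U i)) = (\<Prod>k=1..n. fac J k (U k))" for J U
  proof -
    have "concat_blocks s n U (Suc ((k - 1) * s + (r - 1))) = U k r" if "k \<in> {1..n}" "r \<in> {1..s}" for k r
      using concat_blocks_apply[of "k - 1" n "r - 1" s U] that by auto
    then show ?thesis
      unfolding prod_blocks fac_def ix_def by (intro prod.cong refl) (simp only:)
  qed
  have fac: "integrable (uniform_cube s) (fac J k)"
    "(\<integral>u. fac J k u \<partial>uniform_cube s) = (\<Prod>r=1..s. t (ix k r) (Suc (J (ix k r))) - t (ix k r) (J (ix k r)))"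
    if "J \<in> ?J" "k \<in> {1..n}" for J k
    unfolding fac_def
    by (rule uniform_cube_box; use is_grid_interval[OF g[unfolded P] that(1) ix[OF that(2)]] in \<open>auto simp: less_imp_le\<close>)+
  have int: "integrable Q (\<lambda>U. \<Prod>k=1..n. fac J k (U k))" if "J \<in> ?J" for J
    unfolding Q_def by (rule product_integrable_prod) (use fac(1)[OF that] in auto)
  have val: "(\<integral>U. (\<Prod>k=1..n. fac J k (U k)) \<partial>Q) = cell_volume (n * s) t J" if "J \<in> ?J" for J
  proof -
    have "(\<integral>U. (\<Prod>k=1..n. fac J k (U k)) \<partial>Q) = (\<Prod>k=1..n. \<integral>u. fac J k u \<partial>uniform_cube s)"
      unfolding Q_def by (rule product_integral_prod) (use fac(1)[OF that] in auto)
    also have "\<dots> = cell_volume (n * s) t J"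
      unfolding cell_volume_def prod_blocks by (intro prod.cong refl) (simp add: fac(2)[OF that] ix_def)
    finally show ?thesis .
  qed
  show "integrable Q (\<lambda>U. grid_step (n * s) P c (concat_blocks s n U))"
    unfolding P grid_step_def split_conv eq
    by (intro Bochner_Integration.integrable_sum integrable_mult_right int)
  show "(\<integral>U. grid_step (n * s) P c (concat_blocks s n U) \<partial>Q) = grid_step_integral (n * s) P c"
    unfolding P grid_step_def grid_step_integral_def split_conv eq
    using int val by (subst Bochner_Integration.integral_sum) auto
qed

text \<open>Both integrals lie between those of step functions below and above \<open>H\<close>, for
  which the Darboux and the Lebesgue value agree.\<close>

lemma riemann_integral_eq:
  assumes H: "riemann_integrable_open_cube (n * s) H" and s: "s \<ge> 1"
  defines "Q \<equiv> \<Pi>\<^sub>M k\<in>{1..n}. uniform_cube s"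
  assumes int: "integrable Q (\<lambda>U. H (concat_blocks s n U))"
  shows "upper_integral (n * s) (\<lambda>z. if z \<in> open_cube (n * s) then H z else 0) = (\<integral>U. H (concat_blocks s n U) \<partial>Q)"
    (is "?I = ?E")
proof (rule antisym)
  have cube: "concat_blocks s n U \<in> open_cube (n * s)" if "U \<in> space Q" for U
    using that s by (intro concat_blocks_open_cube) (auto simp: Q_def space_PiM space_uniform_cube PiE_iff)
  show "?I \<le> ?E"
  proof (rule field_le_epsilon)
    fix e :: real assume "e > 0"
    from riemann_open_cube_grid_lower[OF H this] obtain P c where P: "is_grid (n * s) P"
      "\<And>z. z \<in> open_cube (n * s) \<Longrightarrow> grid_step (n * s) P c z \<le> H z" "?I - e < grid_step_integral (n * s) P c"
      by metis
    have "(\<integral>U. grid_step (n * s) P c (concat_blocks s n U) \<partial>Q) \<le> ?E"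
      using integral_grid_step(1)[OF P(1) s] int P(2) cube unfolding Q_def by (intro integral_mono) auto
    then have "grid_step_integral (n * s) P c \<le> ?E" using integral_grid_step(2)[OF P(1) s] by (simp add: Q_def)
    with P(3) show "?I \<le> ?E + e" by linarith
  qed
  show "?E \<le> ?I"
  proof (rule field_le_epsilon)
    fix e :: real assume "e > 0"
    from riemann_open_cube_grid_upper[OF H this] obtain P c where P: "is_grid (n * s) P"
      "\<And>z. z \<in> open_cube (n * s) \<Longrightarrow> H z \<le> grid_step (n * s) P c z" "grid_step_integral (n * s) P c < ?I + e"
      by metis
    have "?E \<le> (\<integral>U. grid_step (n * s) P c (concat_blocks s n U) \<partial>Q)"
      using integral_grid_step(1)[OF P(1) s] int P(2) cube unfolding Q_def by (intro integral_mono) auto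
    then have "?E \<le> grid_step_integral (n * s) P c" using integral_grid_step(2)[OF P(1) s] by (simp add: Q_def)
    with P(3) show "?E \<le> ?I + e" by linarith
  qed
qed

section \<open>Integrating out the last coordinate\<close>

text \<open>The entry \<open>z n\<close> is overwritten, so the value depends only on the other
  coordinates.\<close>

definition last_integral :: "nat \<Rightarrow> ((nat \<Rightarrow> real) \<Rightarrow> real) \<Rightarrow> (nat \<Rightarrow> real) \<Rightarrow> real" where
  "last_integral n g z = (\<integral>x. g (z(n := x)) \<partial>restrict_space lborel {0<..<1})"

text \<open>Only the factor of coordinate \<open>n\<close> contains the integration variable, and it
  integrates to the length of its interval.\<close>

lemma last_integral_grid_step:
  assumes g: "is_grid n (m, t)" and n: "n \<ge> 1"
  shows "integrable (restrict_space lborel {0<..<1}) (\<lambda>x. grid_step n (m, t) c (z(n := x)))"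
    "last_integral n (grid_step n (m, t) c) z = (\<Sum>J\<in>(\<Pi>\<^sub>E i\<in>{1..n}. {..<m i}).
       c J * (t n (Suc (J n)) - t n (J n)) * (\<Prod>i\<in>{1..<n}. indicator {t i (J i)<..t i (Suc (J i))} (z i)))"
proof -
  let ?J = "\<Pi>\<^sub>E i\<in>{1..n}. {..<m i}"
  have ins: "{1..n} = insert n {1..<n}" using n by auto
  have eq: "(\<Prod>i=1..n. indicator {t i (J i)<..t i (Suc (J i))} ((z(n := x)) i))
      = indicator {t n (J n)<..t n (Suc (J n))} x * (\<Prod>i\<in>{1..<n}. indicator {t i (J i)<..t i (Suc (J i))} (z i) :: real)" for J x
    unfolding ins by (subst prod.insert) (auto intro!: prod.cong)
  have ind: "integrable (restrict_space lborel {0<..<1}) (indicator {t n (J n)<..t n (Suc (J n))} :: real \<Rightarrow> real)"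
    "(\<integral>x. indicator {t n (J n)<..t n (Suc (J n))} x \<partial>restrict_space lborel {0<..<1}) = t n (Suc (J n)) - t n (J n)"
    if "J \<in> ?J" for J
    using unit_interval_indicator[of "t n (J n)" "t n (Suc (J n))"] is_grid_interval[OF g that, of n] n by auto
  have int: "integrable (restrict_space lborel {0<..<1}) (\<lambda>x. c J * (indicator {t n (J n)<..t n (Suc (J n))} x
      * (\<Prod>i\<in>{1..<n}. indicator {t i (J i)<..t i (Suc (J i))} (z i) :: real)))" if "J \<in> ?J" for J
    using ind(1)[OF that] by simp
  show "integrable (restrict_space lborel {0<..<1}) (\<lambda>x. grid_step n (m, t) c (z(n := x)))"
    unfolding grid_step_def split_conv eq by (intro Bochner_Integration.integrable_sum int)
  have val: "(\<integral>x. c J * (indicator {t n (J n)<..t n (Suc (J n))} x * X) \<partial>restrict_space lborel {0<..<1})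
      = c J * (t n (Suc (J n)) - t n (J n)) * X" if "J \<in> ?J" for J X
    by (simp only: integral_mult_right_zero integral_mult_left_zero ind(2)[OF that] mult.assoc)
  show "last_integral n (grid_step n (m, t) c) z = (\<Sum>J\<in>?J.
       c J * (t n (Suc (J n)) - t n (J n)) * (\<Prod>i\<in>{1..<n}. indicator {t i (J i)<..t i (Suc (J i))} (z i)))"
    unfolding last_integral_def grid_step_def split_conv eq
    by (subst Bochner_Integration.integral_sum[OF int]) (assumption, intro sum.cong refl val)
qed

text \<open>What remains is a combination of boxes in the coordinates below \<open>n\<close>, which
  are equidistributed along blocks; the length of the last interval times the remaining volume is
  the cell volume.\<close>

lemma cud_has_avg_last_integral_grid_step:
  assumes "cud v" and v: "\<And>i. v i \<in> {0<..<1}" and s: "s \<ge> 1"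
    and g: "is_grid n P" and n: "n \<ge> 1"
  shows "has_avg (\<lambda>l. last_integral n (grid_step n P c) (\<lambda>r\<in>{1..n}. v (l * s + k + r))) (grid_step_integral n P c)"
proof -
  obtain m t where P: "P = (m, t)" by (cases P)
  let ?J = "\<Pi>\<^sub>E i\<in>{1..n}. {..<m i}"
  have "has_avg (\<lambda>l. \<Sum>J\<in>?J. (c J * (t n (Suc (J n)) - t n (J n)))
      * (\<Prod>i\<in>{1..<n}. indicator {t i (J i)<..t i (Suc (J i))} (v (l * s + k + i))))
    (\<Sum>J\<in>?J. (c J * (t n (Suc (J n)) - t n (J n))) * (\<Prod>i\<in>{1..<n}. t i (Suc (J i)) - t i (J i)))"
  proof (intro has_avg_sum has_avg_cmult)
    fix J assume "J \<in> ?J"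
    from is_grid_interval[OF g[unfolded P] this]
    show "has_avg (\<lambda>l. \<Prod>i\<in>{1..<n}. indicator {t i (J i)<..t i (Suc (J i))} (v (l * s + k + i)))
         (\<Prod>i\<in>{1..<n}. t i (Suc (J i)) - t i (J i))"
      by (intro cud_has_avg_box_arith_prog assms) (auto simp: less_imp_le)
  qed (auto intro!: finite_PiE)
  moreover have "(\<Sum>J\<in>?J. (c J * (t n (Suc (J n)) - t n (J n))) * (\<Prod>i\<in>{1..<n}. t i (Suc (J i)) - t i (J i)))
      = grid_step_integral n P c"
  proof -
    have "{1..n} = insert n {1..<n}" using n by auto
    then show ?thesis by (simp add: P grid_step_integral_def cell_volume_def mult.assoc)
  qed
  ultimately show ?thesis
    unfolding P last_integral_grid_step(2)[OF g[unfolded P] n] by simp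
qed

text \<open>Integration over the last coordinate preserves the inequalities between \<open>H\<close>
  and the step functions below and above it, so the averages are squeezed to the integral of
  \<open>H\<close>.\<close>

lemma cud_has_avg_last_integral:
  assumes "cud v" and v: "\<And>i. v i \<in> {0<..<1}" and s: "s \<ge> 1" and n: "n \<ge> 1"
    and H: "riemann_integrable_open_cube n H"
    and int: "\<And>z. z \<in> open_cube n \<Longrightarrow> integrable (restrict_space lborel {0<..<1}) (\<lambda>x. H (z(n := x)))"
  shows "has_avg (\<lambda>l. last_integral n H (\<lambda>r\<in>{1..n}. v (l * s + k + r)))
     (upper_integral n (\<lambda>z. if z \<in> open_cube n then H z else 0))" (is "has_avg ?w ?I")
proof (rule has_avg_sandwich)
  fix e :: real assume e: "e > 0"
  obtain P c where P: "is_grid n P" "\<And>z. z \<in> open_cube n \<Longrightarrow> grid_step n P c z \<le> H z"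
    "?I - e < grid_step_integral n P c"
    using riemann_open_cube_grid_lower[OF H e] by metis
  obtain P' c' where P': "is_grid n P'" "\<And>z. z \<in> open_cube n \<Longrightarrow> H z \<le> grid_step n P' c' z"
    "grid_step_integral n P' c' < ?I + e"
    using riemann_open_cube_grid_upper[OF H e] by metis
  define z where "z l = (\<lambda>r\<in>{1..n}. v (l * s + k + r))" for l
  have z: "z l \<in> open_cube n" for l using v by (auto simp: z_def open_cube_def)
  have upd: "(z l)(n := x) \<in> open_cube n" if "x \<in> {0<..<1}" for l x
    using z[of l] that n unfolding open_cube_def by (auto simp: PiE_iff extensional_def)
  have gint: "integrable (restrict_space lborel {0<..<1}) (\<lambda>x. grid_step n P c (y(n := x)))" if "is_grid n P" for P c y
    using last_integral_grid_step(1)[of n "fst P" "snd P" c y] that n by simp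
  have "last_integral n (grid_step n P c) (z l) \<le> ?w l" for l
    unfolding last_integral_def z_def[symmetric]
    by (intro integral_mono gint P(1) int z) (use P(2) upd in \<open>auto simp: space_restrict_space\<close>)
  moreover have "?w l \<le> last_integral n (grid_step n P' c') (z l)" for l
    unfolding last_integral_def z_def[symmetric]
    by (intro integral_mono gint P'(1) int z) (use P'(2) upd in \<open>auto simp: space_restrict_space\<close>)
  moreover have "has_avg (\<lambda>l. last_integral n (grid_step n P c) (z l)) (grid_step_integral n P c)"
    unfolding z_def by (intro cud_has_avg_last_integral_grid_step assms P(1))
  moreover have "has_avg (\<lambda>l. last_integral n (grid_step n P' c') (z l)) (grid_step_integral n P' c')"
    unfolding z_def by (intro cud_has_avg_last_integral_grid_step assms P'(1))
  ultimately show "\<exists>x y a b. has_avg x a \<and> has_avg y b \<and> (\<forall>l. x l \<le> ?w l \<and> ?w l \<le> y l) \<and> ?I - e < a \<and> b < ?I + e"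
    using P(3) P'(3) by blast
qed

section \<open>The accepted sample and the weighted mean\<close>

text \<open>The contribution of a single iteration, separated from the chain so that it can be
  evaluated at any carried-over sample.\<close>

definition mp_mean ::
    "nat \<Rightarrow> (real, 'd::{finite,linorder}) vec set \<Rightarrow> ((real, 'd) vec \<Rightarrow> real) \<Rightarrow>
     ((real, 'd) vec \<Rightarrow> (nat \<Rightarrow> (real, 'd) vec) \<Rightarrow> real) \<Rightarrow> ((real, 'd) vec \<Rightarrow> real) \<Rightarrow>
     (real, 'd) vec \<Rightarrow> (nat \<Rightarrow> real) \<Rightarrow> real" where
  "mp_mean N \<Omega> \<pi> \<kappa> f x u =
     (\<Sum>i=1..N+1. weight N \<pi> \<kappa> (points N \<Omega> \<kappa> x u) i * f (points N \<Omega> \<kappa> x u i))"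

lemma mp_estimator_eq:
  "mp_estimator N \<Omega> \<pi> \<kappa> f x0 U L =
     (\<Sum>l<L. mp_mean N \<Omega> \<pi> \<kappa> f (driven_chain (mp_update N \<Omega> \<pi> \<kappa>) x0 U l) (U (Suc l))) / real L"
  by (simp add: mp_estimator_def mp_mean_def mp_points_def sum.atLeast1_atMost_eq)

text \<open>The degenerate case is covered by the convention that the carried-over sample then has
  weight 1.\<close>

lemma sum_weight: "(\<Sum>i=1..N+1. weight N \<pi> \<kappa> y i) = 1"
proof (cases "(\<Sum>j=1..N+1. raw_weight N \<pi> \<kappa> y j) = 0")
  case True
  then show ?thesis by (simp add: weight_def cong: if_cong)
next
  case False
  then have "(\<Sum>i=1..N+1. weight N \<pi> \<kappa> y i)
      = (\<Sum>i=1..N+1. raw_weight N \<pi> \<kappa> y i / (\<Sum>j=1..N+1. raw_weight N \<pi> \<kappa> y j))"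
    unfolding weight_def by (simp only: if_False)
  also have "\<dots> = 1" unfolding sum_divide_distrib[symmetric] using False by simp
  finally show ?thesis .
qed

lemma weight_nonneg:
  assumes "\<And>i. i \<in> {1..N+1} \<Longrightarrow> 0 \<le> raw_weight N \<pi> \<kappa> y i" "i \<in> {1..N+1}"
  shows "0 \<le> weight N \<pi> \<kappa> y i"
proof -
  have "0 \<le> (\<Sum>j=1..N+1. raw_weight N \<pi> \<kappa> y j)" by (intro sum_nonneg assms(1))
  from divide_nonneg_nonneg[OF assms(1)[OF assms(2)] this] show ?thesis
    unfolding weight_def by (simp del: sum.cl_ivl_Suc)
qed

text \<open>The intervals between consecutive cumulative weights partition \<open>{0<..1}\<close>.
  Written as a sum, the selection by \<open>THE\<close> becomes a step function of \<open>t\<close>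
  that can be integrated.\<close>

lemma accepted_index_sum:
  fixes g :: "nat \<Rightarrow> real"
  assumes w: "\<And>i. i \<in> {1..N+1} \<Longrightarrow> 0 \<le> weight N \<pi> \<kappa> y i" and t: "t \<in> {0<..1}"
  shows "g (accepted_index N \<pi> \<kappa> y t) =
     (\<Sum>j=1..N+1. indicator {cum_weight N \<pi> \<kappa> y (j - 1)<..cum_weight N \<pi> \<kappa> y j} t * g j)"
proof -
  let ?c = "cum_weight N \<pi> \<kappa> y"
  have mono: "?c i \<le> ?c j" if "i \<le> j" "j \<le> N + 1" for i j
    unfolding cum_weight_def using that by (intro sum_mono2) (auto intro: w)
  \<comment> \<open>The cumulative weights run from 0 to 1, so there is a first one that is not
    below \<open>t\<close>.\<close>
  have "t \<le> ?c (N + 1)" "\<not> t \<le> ?c 0" using t sum_weight[of N \<pi> \<kappa> y] by (auto simp: cum_weight_def)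
  then obtain j where j: "j < N + 1" "t \<le> ?c (Suc j)" "\<not> t \<le> ?c j"
    using ex_least_nat_less[of "\<lambda>j. t \<le> ?c j" "N + 1"] by auto
  have uniq: "i = Suc j" if "i \<in> {1..N+1}" "t \<in> {?c (i - 1)<..?c i}" for i
  proof (rule ccontr)
    assume "i \<noteq> Suc j"
    then consider "i \<le> j" | "Suc j \<le> i - 1" by linarith
    then show False
    proof cases
      case 1
      from mono[OF this] j that show False by auto
    next
      case 2
      then have "?c (Suc j) \<le> ?c (i - 1)" using that(1) by (intro mono) auto
      with j that show False by auto
    qed
  qed
  have acc: "accepted_index N \<pi> \<kappa> y t = Suc j"
    unfolding accepted_index_def using j uniq by (intro the_equality) auto
  have mem: "Suc j \<in> {1..N+1}" using j(1) by simp
  have rest: "(\<Sum>i\<in>{1..N+1} - {Suc j}. indicator {?c (i - 1)<..?c i} t * g i) = 0"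
    by (rule sum.neutral) (use uniq in \<open>auto simp: indicator_def\<close>)
  have "(\<Sum>j=1..N+1. indicator {?c (j - 1)<..?c j} t * g j) = indicator {?c (Suc j - 1)<..?c (Suc j)} t * g (Suc j)"
    by (simp only: sum.remove[OF finite_atLeastAtMost mem] rest add_0_right)
  also have "\<dots> = g (Suc j)" using j by simp
  finally show ?thesis by (simp only: acc)
qed

locale mp_sampler =
  fixes N :: nat and \<Omega> :: "(real ^ 'd::{finite,linorder}) set" and \<pi> :: "(real, 'd) vec \<Rightarrow> real"
    and \<kappa> :: "(real, 'd) vec \<Rightarrow> (nat \<Rightarrow> (real, 'd) vec) \<Rightarrow> real"
  assumes \<pi>: "\<And>x. x \<in> \<Omega> \<Longrightarrow> 0 \<le> \<pi> x"
    and \<kappa>: "\<And>x y. x \<in> \<Omega> \<Longrightarrow> y \<in> {1..N} \<rightarrow>\<^sub>E \<Omega> \<Longrightarrow> 0 \<le> \<kappa> x y"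
    and inv: "\<And>y u. y \<in> \<Omega> \<Longrightarrow> u \<in> open_cube (N * CARD('d)) \<Longrightarrow> inverse_cdf N \<Omega> (\<kappa> y) u \<in> {1..N} \<rightarrow>\<^sub>E \<Omega>"
begin

lemma points_in:
  assumes "x \<in> \<Omega>" "u \<in> open_cube (N * CARD('d) + 1)" "i \<in> {1..N+1}"
  shows "points N \<Omega> \<kappa> x u i \<in> \<Omega>"
proof -
  have "restrict u {1..N * CARD('d)} \<in> open_cube (N * CARD('d))"
    using assms(2) by (auto simp: open_cube_def PiE_iff)
  from inv[OF assms(1) this] show ?thesis
    using assms(1,3) by (cases "i = N + 1") (auto simp: points_def PiE_iff)
qed

lemma weight_points_nonneg:
  assumes "x \<in> \<Omega>" "u \<in> open_cube (N * CARD('d) + 1)" "i \<in> {1..N+1}"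
  shows "0 \<le> weight N \<pi> \<kappa> (points N \<Omega> \<kappa> x u) i"
proof (rule weight_nonneg[OF _ assms(3)])
  fix i assume i: "i \<in> {1..N+1}"
  have "remove_at N i (points N \<Omega> \<kappa> x u) \<in> {1..N} \<rightarrow>\<^sub>E \<Omega>"
    using points_in[OF assms(1,2)] by (auto simp: remove_at_def)
  then show "0 \<le> raw_weight N \<pi> \<kappa> (points N \<Omega> \<kappa> x u) i"
    unfolding raw_weight_def using points_in[OF assms(1,2) i] by (intro mult_nonneg_nonneg \<pi> \<kappa>)
qed

text \<open>The mean is a convex combination of values of \<open>f\<close> on
  \<open>\<Omega>\<close>.\<close>

lemma mp_mean_bound:
  assumes "x \<in> \<Omega>" "u \<in> open_cube (N * CARD('d) + 1)" "\<And>x. x \<in> \<Omega> \<Longrightarrow> \<bar>f x\<bar> \<le> B"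
  shows "\<bar>mp_mean N \<Omega> \<pi> \<kappa> f x u\<bar> \<le> B"
proof -
  have "\<bar>mp_mean N \<Omega> \<pi> \<kappa> f x u\<bar> \<le> (\<Sum>i=1..N+1. weight N \<pi> \<kappa> (points N \<Omega> \<kappa> x u) i * B)"
    unfolding mp_mean_def
  proof (intro order.trans[OF sum_abs] sum_mono)
    fix i assume i: "i \<in> {1..N+1}"
    show "\<bar>weight N \<pi> \<kappa> (points N \<Omega> \<kappa> x u) i * f (points N \<Omega> \<kappa> x u i)\<bar>
        \<le> weight N \<pi> \<kappa> (points N \<Omega> \<kappa> x u) i * B"
      using weight_points_nonneg[OF assms(1,2) i] assms(3)[OF points_in[OF assms(1,2) i]]
      by (auto simp: abs_mult intro!: mult_left_mono)
  qed
  also have "\<dots> = B" by (simp only: sum_distrib_right[symmetric] sum_weight mult_1)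
  finally show ?thesis .
qed

text \<open>The last coordinate of the seed only selects the accepted index, so integrating it out
  replaces the accepted sample by the weighted mean of all proposals.\<close>

lemma integral_mp_update_last:
  assumes "x \<in> \<Omega>" "u \<in> open_cube (N * CARD('d) + 1)"
  shows "integrable (restrict_space lborel {0<..<1})
      (\<lambda>t. f (mp_update N \<Omega> \<pi> \<kappa> x (u(N * CARD('d) + 1 := t))))"
    "(\<integral>t. f (mp_update N \<Omega> \<pi> \<kappa> x (u(N * CARD('d) + 1 := t))) \<partial>restrict_space lborel {0<..<1}) = mp_mean N \<Omega> \<pi> \<kappa> f x u"
proof -
  define y where "y = points N \<Omega> \<kappa> x u"
  define c where "c = cum_weight N \<pi> \<kappa> y"
  \<comment> \<open>The accepted value as a step function of the last seed coordinate, with steps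
    whose lengths are the weights.\<close>
  define g where "g t = (\<Sum>j=1..N+1. indicator {c (j - 1)<..c j} t * f (y j))" for t :: real
  have w: "0 \<le> weight N \<pi> \<kappa> y i" if "i \<in> {1..N+1}" for i
    unfolding y_def by (rule weight_points_nonneg[OF assms that])
  have c: "0 \<le> c (j - 1)" "c (j - 1) \<le> c j" "c j \<le> 1" "c j - c (j - 1) = weight N \<pi> \<kappa> y j" if j: "j \<in> {1..N+1}" for j
  proof -
    show "0 \<le> c (j - 1)" unfolding c_def cum_weight_def using j by (intro sum_nonneg w) auto
    have "c j \<le> (\<Sum>i=1..N+1. weight N \<pi> \<kappa> y i)"
      unfolding c_def cum_weight_def using j by (intro sum_mono2) (auto intro: w)
    then show "c j \<le> 1" unfolding sum_weight .
    obtain k where k: "j = Suc k" using j by (cases j) auto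
    show eq: "c j - c (j - 1) = weight N \<pi> \<kappa> y j" by (simp add: k c_def cum_weight_def)
    then show "c (j - 1) \<le> c j" using w[OF j] by linarith
  qed
  \<comment> \<open>The proposals are built from the first \<open>N * CARD('d)\<close> coordinates,
    so they do not move with \<open>t\<close>.\<close>
  have "restrict (u(N * CARD('d) + 1 := t)) {1..N * CARD('d)} = restrict u {1..N * CARD('d)}" for t
    by (auto simp: restrict_def)
  then have "points N \<Omega> \<kappa> x (u(N * CARD('d) + 1 := t)) = y" for t by (simp only: points_def y_def)
  then have eq: "f (mp_update N \<Omega> \<pi> \<kappa> x (u(N * CARD('d) + 1 := t))) = g t" if "t \<in> {0<..<1}" for t
    unfolding mp_update_def Let_def g_def c_def fun_upd_same
    using accepted_index_sum[OF w, where g = "\<lambda>j. f (y j)" and t = t] that by auto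
  have int: "integrable (restrict_space lborel {0<..<1}) (\<lambda>t. indicator {c (j - 1)<..c j} t * f (y j))"
    and val: "(\<integral>t. indicator {c (j - 1)<..c j} t * f (y j) \<partial>restrict_space lborel {0<..<1}) = weight N \<pi> \<kappa> y j * f (y j)"
    if "j \<in> {1..N+1}" for j
    using unit_interval_indicator[OF c(1-3)[OF that]] c(4)[OF that]
    by (simp_all only: integral_mult_left_zero integrable_mult_left)
  have "integrable (restrict_space lborel {0<..<1}) g"
    unfolding g_def using int by (intro Bochner_Integration.integrable_sum)
  then show "integrable (restrict_space lborel {0<..<1}) (\<lambda>t. f (mp_update N \<Omega> \<pi> \<kappa> x (u(N * CARD('d) + 1 := t))))"
    by (rule Bochner_Integration.integrable_cong[THEN iffD2, rotated 2]) (rule refl, rule eq, simp add: space_restrict_space)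
  have "(\<integral>t. f (mp_update N \<Omega> \<pi> \<kappa> x (u(N * CARD('d) + 1 := t))) \<partial>restrict_space lborel {0<..<1})
      = (\<integral>t. g t \<partial>restrict_space lborel {0<..<1})"
    by (rule Bochner_Integration.integral_cong[OF refl], rule eq) (simp add: space_restrict_space)
  also have "\<dots> = (\<Sum>j=1..N+1. weight N \<pi> \<kappa> y j * f (y j))"
    unfolding g_def by (subst Bochner_Integration.integral_sum[OF int]) (assumption, intro sum.cong refl val)
  finally show "(\<integral>t. f (mp_update N \<Omega> \<pi> \<kappa> x (u(N * CARD('d) + 1 := t))) \<partial>restrict_space lborel {0<..<1}) = mp_mean N \<Omega> \<pi> \<kappa> f x u"
    by (simp only: mp_mean_def y_def)
qed

end

section \<open>Convergence of the estimator\<close>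

text \<open>The number of visits of \<open>M\<close> consecutive blocks to a box of volume \<open>p\<close> has mean \<open>M p\<close> and
  variance at most \<open>M\<close>, so by Chebyshev's inequality the proportion of windows without any visit
  is at most \<open>1 / (M p\<^sup>2)\<close>. Here \<open>1 / M + E\<close> dominates the squared deviation.\<close>

lemma cud_has_avg_uncoupled:
  assumes "cud v" and v: "\<And>i. v i \<in> {0<..<1}" and s: "s \<ge> 1" and M: "M \<ge> 1"
    and ab: "\<And>r. r \<in> {1..s} \<Longrightarrow> 0 \<le> a r \<and> a r < b r \<and> b r \<le> (1::real)"
  obtains E where "has_avg E 0" "\<And>l. 0 \<le> 1 / real M + E l"
    "\<And>l. \<forall>k\<in>{1..M}. block s v (l + k) \<notin> (\<Pi>\<^sub>E r\<in>{1..s}. {a r<..b r}) \<Longrightarrow>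
       (\<Prod>r=1..s. b r - a r)\<^sup>2 \<le> 1 / real M + E l"
proof -
  define p where "p = (\<Prod>r=1..s. b r - a r)"
  \<comment> \<open>Indicator of a visit by block \<open>l + 1\<close>, whose coordinates are
    \<open>v (l * s + s + r)\<close>.\<close>
  define x where "x l = (\<Prod>r=1..s. indicator {a r<..b r} (v (l * s + s + r)) :: real)" for l
  have box: "0 \<le> a r \<and> a r \<le> b r \<and> b r \<le> 1" if "r \<in> {1..s}" for r using ab[OF that] by auto
  have x01: "x i \<in> {0..1}" for i unfolding x_def by (auto intro!: prod_nonneg prod_le_1)
  have avg: "has_avg x p"
    unfolding x_def p_def by (rule cud_has_avg_box_arith_prog[OF assms(1) v _ box s]) auto
  have p: "p \<in> {0..1}"
    using box by (auto simp: p_def intro!: prod_nonneg prod_le_1) fastforce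
  have lag: "has_avg (\<lambda>i. x i * x (i + d * 1)) (p\<^sup>2)" if "d \<ge> 1" for d
  proof -
    \<comment> \<open>A lag of \<open>d\<close> blocks translates coordinates by
      \<open>d * s\<close>, which moves \<open>{1..s}\<close> off itself.\<close>
    have "s \<le> d * s" using that by simp
    then have "r + d * s \<notin> {1..s}" if "r \<in> {1..s}" for r
      using that unfolding atLeastAtMost_iff by linarith
    then show ?thesis
    proof (rule box_product_lag[OF finite_atLeastAtMost _ box])
      fix K' a' b'
      assume K': "finite K'" "\<And>r. r \<in> K' \<Longrightarrow> 0 \<le> a' r \<and> a' r \<le> b' r \<and> b' r \<le> (1::real)"
        and eq: "\<And>w. (\<Prod>r=1..s. indicator {a r<..b r} (w r)) * (\<Prod>r=1..s. indicator {a r<..b r} (w (r + d * s)))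
          = (\<Prod>r\<in>K'. indicator {a' r<..b' r} (w r) :: real)"
        and vol: "(\<Prod>r\<in>K'. b' r - a' r) = (\<Prod>r=1..s. b r - a r)\<^sup>2"
      have "x l * x (l + d * 1) = (\<Prod>r\<in>K'. indicator {a' r<..b' r} (v (l * s + s + r)))" for l
        using eq[of "\<lambda>r. v (l * s + s + r)"] by (simp add: x_def algebra_simps)
      moreover have "has_avg (\<lambda>l. \<Prod>r\<in>K'. indicator {a' r<..b' r} (v (l * s + s + r))) (\<Prod>r\<in>K'. b' r - a' r)"
        by (rule cud_has_avg_box_arith_prog[OF assms(1) v K'(1) _ s]) (use K'(2) in auto)
      ultimately show ?thesis by (simp only: vol p_def)
    qed
  qed
  obtain E where E: "has_avg E 0"
    "\<And>i. ((\<Sum>m<M. x (i + m * 1) - p) / real M)\<^sup>2 \<le> 1 / real M + E i"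
    by (rule moving_average_square_le[OF x01 avg p lag M]) (assumption, rule that)
  show ?thesis
  proof (rule that[OF E(1)])
    show "0 \<le> 1 / real M + E l" for l using E(2)[of l] by (meson order_trans zero_le_power2)
    fix l assume un: "\<forall>k\<in>{1..M}. block s v (l + k) \<notin> (\<Pi>\<^sub>E r\<in>{1..s}. {a r<..b r})"
    have "x (l + m) = 0" if "m < M" for m
    proof -
      have "x (l + m) = (\<Prod>r=1..s. indicator {a r<..b r} (block s v (l + Suc m) r))"
        unfolding x_def by (intro prod.cong refl) (auto simp: block_def algebra_simps)
      also have "\<dots> = indicator (\<Pi>\<^sub>E r\<in>{1..s}. {a r<..b r}) (block s v (l + Suc m))"
        by (rule indicator_box_eq[symmetric]) (simp_all only: block_def restrict_extensional finite_atLeastAtMost)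
      also have "\<dots> = 0" using bspec[OF un, of "Suc m"] that by simp
      finally show ?thesis .
    qed
    then have "(\<Sum>m<M. x (l + m * 1) - p) / real M = - p" using M by simp
    with E(2)[of l] show "(\<Prod>r=1..s. b r - a r)\<^sup>2 \<le> 1 / real M + E l" by (simp add: p_def)
  qed
qed

theorem corollary5p5:
  fixes N :: nat
    and \<Omega> :: "(real ^ 'd::{finite,linorder}) set"
    and \<pi> f :: "(real, 'd) vec \<Rightarrow> real"
    and \<kappa> :: "(real, 'd) vec \<Rightarrow> (nat \<Rightarrow> (real, 'd) vec) \<Rightarrow> real"
    and x0 :: "(real, 'd) vec"
    and v :: "nat \<Rightarrow> real"
    and C :: "(nat \<Rightarrow> real) set"
  defines "s \<equiv> N * CARD('d) + 1"
    and "\<phi> \<equiv> mp_update N \<Omega> \<pi> \<kappa>"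
  assumes "N \<ge> 1"
    and "\<Omega> \<in> sets borel"
    and "prob_density_on lborel \<Omega> \<pi>"
    and "\<forall>y\<in>\<Omega>. prob_density_on (\<Pi>\<^sub>M i\<in>{1..N}. lborel) ({1..N} \<rightarrow>\<^sub>E \<Omega>) (\<kappa> y)"
    and "\<forall>y\<in>\<Omega>. \<forall>u\<in>open_cube (N * CARD('d)). inverse_cdf N \<Omega> (\<kappa> y) u \<in> {1..N} \<rightarrow>\<^sub>E \<Omega>"
    and "x0 \<in> \<Omega>"
    and "continuous_on \<Omega> f" and "bounded (f ` \<Omega>)"
    and "\<forall>i. v i \<in> {0<..<1}" and "cud v"
    and "positive_harris (restrict_space borel \<Omega>) (uniform_cube s) \<phi>
           (density (restrict_space lborel \<Omega>) (\<lambda>x. ennreal (\<pi> x)))"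
    and "regular_update s \<Omega> \<phi> x0"
    and "coupling_region s \<Omega> \<phi> C"
  shows "(\<lambda>L. mp_estimator N \<Omega> \<pi> \<kappa> f x0 (block s v) L) \<longlonglongrightarrow> (LINT x:\<Omega>|lborel. f x * \<pi> x)"
proof -

  \<comment> \<open>Setting and direct consequences of the hypotheses\<close>
  define S where "S = restrict_space borel \<Omega>"
  define R where "R = uniform_cube s"
  define D where "D = density (restrict_space lborel \<Omega>) (\<lambda>x. ennreal (\<pi> x))"
  define I where "I = (LINT x:\<Omega>|lborel. f x * \<pi> x)"
  define U where "U = block s v"
  define A where "A m = (markov_op R \<phi> ^^ m) f x0" for m
  have \<Omega>: "\<Omega> \<in> sets borel" and x0: "x0 \<in> \<Omega>" by fact+
  have v: "\<And>i. v i \<in> {0<..<1}" and cud: "cud v" using assms by auto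
  have s: "s \<ge> 1" by (simp add: s_def)
  have mu: "markov_update S R \<phi>" and invD: "invariant_distribution S R \<phi> D"
    using assms(13) by (auto simp: positive_harris_def harris_recurrent_def S_def R_def D_def)
  have spS: "space S = \<Omega>" by (simp add: S_def space_restrict_space)
  have spR: "space R = open_cube s" by (simp add: R_def space_uniform_cube)
  have upd: "\<phi> x u \<in> \<Omega>" if "x \<in> \<Omega>" "u \<in> open_cube s" for x u
    using markov_update_space[OF mu, of x u] that by (simp add: spS spR)
  have \<pi>: "\<And>x. x \<in> \<Omega> \<Longrightarrow> 0 \<le> \<pi> x" and \<pi>m: "\<pi> \<in> borel_measurable (restrict_space lborel \<Omega>)"
    using assms(5) by (auto simp: prob_density_on_def)
  interpret mp_sampler N \<Omega> \<pi> \<kappa>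
    by unfold_locales (use assms(5-7) in \<open>auto simp: prob_density_on_def\<close>)
  note mean_bound = mp_mean_bound[folded s_def]
  note mean_int = integral_mp_update_last[folded s_def \<phi>_def]
  have fm: "f \<in> borel_measurable S"
    unfolding S_def by (rule borel_measurable_continuous_on_restrict) fact
  obtain B where B: "B > 0" "\<And>x. x \<in> \<Omega> \<Longrightarrow> \<bar>f x\<bar> \<le> B"
    using assms(10) by (auto simp: bounded_pos)
  have fB: "\<And>x. x \<in> space S \<Longrightarrow> \<bar>f x\<bar> \<le> B" using B(2) by (simp add: spS)
  have intD: "(\<integral>x. f x \<partial>D) = I"
  proof -
    have fm': "f \<in> borel_measurable (restrict_space lborel \<Omega>)"
      using fm by (simp add: S_def measurable_cong_sets[OF sets_restrict_space_cong[OF sets_lborel] refl])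
    have "(\<integral>x. f x \<partial>D) = (\<integral>x. \<pi> x *\<^sub>R f x \<partial>restrict_space lborel \<Omega>)"
      unfolding D_def
      by (rule integral_density[OF fm' \<pi>m]) (use \<pi> in \<open>auto intro!: AE_I2 simp: space_restrict_space\<close>)
    also have "\<dots> = (LINT x:\<Omega>|lborel. \<pi> x *\<^sub>R f x)"
      by (rule integral_restrict_space[folded set_lebesgue_integral_def]) (use \<Omega> in auto)
    finally show ?thesis by (simp add: I_def mult.commute)
  qed

  \<comment> \<open>The coupling box and geometric ergodicity\<close>
  have cpl: "\<And>u x x'. u \<in> C \<Longrightarrow> x \<in> \<Omega> \<Longrightarrow> x' \<in> \<Omega> \<Longrightarrow> \<phi> x u = \<phi> x' u"
    and jm: "jordan_measurable s C" "jordan_measure s C > 0"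
    using assms(15) unfolding coupling_region_def by blast+
  \<comment> \<open>A Jordan measurable set need not be Borel. A box inside \<open>C\<close> is, up
    to the restriction to the open cube, measurable for the seed law, and its visits can be counted
    by equidistribution.\<close>
  obtain a b where ab: "\<And>r. r \<in> {1..s} \<Longrightarrow> 0 \<le> a r \<and> a r < b r \<and> b r \<le> (1::real)"
    and boxC: "(\<Pi>\<^sub>E r\<in>{1..s}. {a r<..b r}) \<subseteq> C"
    by (rule jordan_measure_pos_contains_box[OF jm]) (rule that)
  define p where "p = (\<Prod>r=1..s. b r - a r)"
  define W where "W = (\<Pi>\<^sub>E r\<in>{1..s}. {a r<..b r}) \<inter> open_cube s"
  have W: "W \<in> sets R" "measure R W = p"
    unfolding W_def R_def p_def using ab by (intro measure_uniform_cube_box; force simp: less_imp_le)+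
  have p: "0 < p" "p \<le> 1"
  proof -
    show "0 < p" unfolding p_def using ab by (intro prod_pos) auto
    interpret prob_space R unfolding R_def by (rule prob_space_uniform_cube)
    show "p \<le> 1" using W(2) prob_le_1[of W] by simp
  qed
  have cplW: "\<phi> x u = \<phi> x' u" if "u \<in> W" "x \<in> space S" "x' \<in> space S" for u x x'
    by (rule cpl) (use that boxC in \<open>auto simp: W_def spS\<close>)
  \<comment> \<open>\<open>A m\<close> is the expectation of \<open>f\<close> after \<open>m\<close>
    steps from \<open>x0\<close> with independent uniform seeds; \<open>2 * B\<close> bounds the
    initial oscillation.\<close>
  have doeblin: "\<bar>A m - I\<bar> \<le> (1 - p) ^ m * (2 * B)" for m
    unfolding A_def intD[symmetric] W(2)[symmetric]
    by (rule funpow_markov_op_invariant[OF mu invD fm fB W(1) cplW]) (simp_all add: spS x0)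

  \<comment> \<open>Averages over windows of blocks with the chain restarted at
    \<open>x0\<close>\<close>
  have U: "U l \<in> open_cube s" for l using v by (auto simp: U_def block_def open_cube_def)
  \<comment> \<open>Counted from 0: \<open>T l\<close> is the contribution of iteration
    \<open>l + 1\<close>.\<close>
  define T where "T l = mp_mean N \<Omega> \<pi> \<kappa> f (driven_chain \<phi> x0 U l) (U (Suc l))" for l
  have chain: "driven_chain \<phi> x (\<lambda>k. U (l + k)) m \<in> \<Omega>" if "x \<in> \<Omega>" for x l m
    by (rule driven_chain_in) (use upd U that in auto)
  have T: "\<bar>T l\<bar> \<le> B" for l
    unfolding T_def by (rule mean_bound) (use chain[OF x0, of 0] U B(2) in auto)
  \<comment> \<open>\<open>M\<close> blocks run the restarted chain and one more gives the weighted
    mean. That mean is \<open>f\<close> of the next accepted sample with the last seed coordinate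
    integrated out, whence \<open>Suc M\<close> steps in the limit.\<close>
  have window: "has_avg (\<lambda>l. mp_mean N \<Omega> \<pi> \<kappa> f (driven_chain \<phi> x0 (\<lambda>k. U (l + k)) M) (U (l + Suc M))) (A (Suc M))" for M
  proof -
    define m where "m = Suc M"
    define H where "H z = f (driven_chain \<phi> x0 (\<lambda>k. block s z (k - 1)) m)" for z
    define Q where "Q = (\<Pi>\<^sub>M k\<in>{1..m}. R)"
    have n: "m * s \<ge> 1" using s by (simp add: m_def)
    have H: "riemann_integrable_open_cube (m * s) H"
      unfolding H_def[abs_def]
      by (rule assms(14)[unfolded regular_update_def, rule_format, of m f])
         (use assms(9,10) in \<open>auto simp: m_def\<close>)
    have blk: "block s z k \<in> open_cube s" if "z \<in> open_cube (m * s)" "k < m" for z k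
    proof -
      have "k * s + r \<in> {1..m * s}" if "r \<in> {1..s}" for r
      proof -
        have "k * s + r \<le> Suc k * s" using that by simp
        also have "\<dots> \<le> m * s" using \<open>k < m\<close> by (intro mult_le_mono1) simp
        finally show ?thesis using that by simp
      qed
      then show ?thesis using that(1) by (auto simp: block_def open_cube_def PiE_iff)
    qed
    \<comment> \<open>The last coordinate of the long vector is coordinate \<open>s\<close> of block
      \<open>M\<close>, counted from 0; the earlier blocks do not contain it.\<close>
    have H_last: "H (z(m * s := t)) = f (\<phi> (driven_chain \<phi> x0 (\<lambda>k. block s z (k - 1)) M) ((block s z M)(s := t)))" for z t
    proof -
      have "driven_chain \<phi> x0 (\<lambda>k. block s (z(m * s := t)) (k - 1)) M = driven_chain \<phi> x0 (\<lambda>k. block s z (k - 1)) M"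
      proof (rule driven_chain_cong)
        fix k assume "k \<in> {1..M}"
        have "(k - 1) * s + r < m * s" if "r \<in> {1..s}" for r
        proof -
          have "(k - 1) * s + r \<le> k * s" using that \<open>k \<in> {1..M}\<close> by (cases k) auto
          also have "\<dots> \<le> M * s" using \<open>k \<in> {1..M}\<close> by simp
          also have "\<dots> < m * s" using s by (simp add: m_def)
          finally show ?thesis .
        qed
        then show "block s (z(m * s := t)) (k - 1) = block s z (k - 1)" by (fastforce simp: block_def)
      qed
      moreover have "block s (z(m * s := t)) M = (block s z M)(s := t)"
        using s by (auto simp: block_def m_def fun_eq_iff)
      moreover have "H y = f (\<phi> (driven_chain \<phi> x0 (\<lambda>k. block s y (k - 1)) M) (block s y M))" for y
        by (simp add: H_def m_def)
      ultimately show ?thesis by (simp only:)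
    qed
    have in\<Omega>: "driven_chain \<phi> x0 (\<lambda>k. block s z (k - 1)) M \<in> \<Omega>" if "z \<in> open_cube (m * s)" for z
    proof -
      \<comment> \<open>Blocks beyond the end of \<open>z\<close> lie outside its domain. They are
        replaced by the admissible seed \<open>U 0\<close>, since \<open>driven_chain_in\<close>
        asks for admissible seeds at all times.\<close>
      have "driven_chain \<phi> x0 (\<lambda>k. block s z (k - 1)) M
          = driven_chain \<phi> x0 (\<lambda>k. if k \<in> {1..M} then block s z (k - 1) else U 0) M"
        by (rule driven_chain_cong) simp
      also have "\<dots> \<in> \<Omega>"
        by (rule driven_chain_in) (use upd x0 blk[OF that] U in \<open>auto simp: m_def\<close>)
      finally show ?thesis .
    qed
    have bM: "block s z M \<in> open_cube s" if "z \<in> open_cube (m * s)" for z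
      using blk[OF that] by (simp add: m_def)
    \<comment> \<open>The offset \<open>s\<close> skips block 0: the first iteration is driven by
      block 1.\<close>
    have "has_avg (\<lambda>l. last_integral (m * s) H (\<lambda>r\<in>{1..m * s}. v (l * s + s + r)))
       (upper_integral (m * s) (\<lambda>z. if z \<in> open_cube (m * s) then H z else 0))"
      by (rule cud_has_avg_last_integral[OF cud v s n H])
         (use mean_int(1)[OF in\<Omega> bM] in \<open>simp add: H_last\<close>)
    moreover have "last_integral (m * s) H (\<lambda>r\<in>{1..m * s}. v (l * s + s + r))
        = mp_mean N \<Omega> \<pi> \<kappa> f (driven_chain \<phi> x0 (\<lambda>k. U (l + k)) M) (U (l + Suc M))" for l
    proof -
      define z where "z = (\<lambda>r\<in>{1..m * s}. v (l * s + s + r))"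
      have z: "z \<in> open_cube (m * s)" using v by (auto simp: z_def open_cube_def)
      have b: "block s z k = U (l + Suc k)" if "k < m" for k
      proof -
        have "k * s + r \<le> m * s" if "r \<in> {1..s}" for r
        proof -
          have "k * s + r \<le> Suc k * s" using that by simp
          also have "\<dots> \<le> m * s" using \<open>k < m\<close> by (intro mult_le_mono1) simp
          finally show ?thesis .
        qed
        then show ?thesis
          by (auto simp: block_def U_def z_def fun_eq_iff algebra_simps)
      qed
      have "driven_chain \<phi> x0 (\<lambda>k. block s z (k - 1)) M = driven_chain \<phi> x0 (\<lambda>k. U (l + k)) M"
        by (rule driven_chain_cong) (use b in \<open>auto simp: m_def\<close>)
      then show ?thesis
        unfolding z_def[symmetric] last_integral_def H_last mean_int(2)[OF in\<Omega>[OF z] bM[OF z]]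
        using b[of M] by (simp add: m_def)
    qed
    \<comment> \<open>Regularity identifies the Darboux integral with an expectation under
      independent uniform seeds, which the iterated transition operator computes.\<close>
    moreover have "upper_integral (m * s) (\<lambda>z. if z \<in> open_cube (m * s) then H z else 0) = A m"
    proof -
      have eq: "H (concat_blocks s m Z) = f (driven_chain \<phi> x0 Z m)" if "Z \<in> space Q" for Z
        unfolding H_def
        by (intro arg_cong[where f = f] driven_chain_cong block_concat_blocks)
           (use that in \<open>auto simp: Q_def space_PiM R_def space_uniform_cube open_cube_def PiE_iff\<close>)
      interpret Q: prob_space Q
        unfolding Q_def R_def by (intro prob_space_PiM prob_space_uniform_cube)
      have chm: "(\<lambda>Z. driven_chain \<phi> x0 Z m) \<in> Q \<rightarrow>\<^sub>M S"
        unfolding Q_def by (rule measurable_driven_chain[OF mu]) (use x0 spS in auto)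
      have "integrable Q (\<lambda>Z. f (driven_chain \<phi> x0 Z m))"
        by (rule Q.integrable_const_bound[where B = B])
           (use measurable_space[OF chm] fB measurable_compose[OF chm fm] in auto)
      then have "integrable Q (\<lambda>Z. H (concat_blocks s m Z))"
        by (rule Bochner_Integration.integrable_cong[THEN iffD2, rotated 2]) (auto simp: eq)
      then have "upper_integral (m * s) (\<lambda>z. if z \<in> open_cube (m * s) then H z else 0)
          = (\<integral>Z. H (concat_blocks s m Z) \<partial>Q)"
        unfolding Q_def R_def by (intro riemann_integral_eq H s)
      also have "\<dots> = (\<integral>Z. f (driven_chain \<phi> x0 Z m) \<partial>Q)"
        by (intro Bochner_Integration.integral_cong refl eq)
      also have "\<dots> = A m"
        unfolding Q_def A_def by (rule integral_driven_chain[OF mu _ fm fB]) (use x0 spS in auto)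
      finally show ?thesis .
    qed
    ultimately show ?thesis by (simp add: m_def)
  qed

  \<comment> \<open>Comparison of the chain with the restarted windows\<close>
  have "has_avg T I"
  proof (rule has_avg_sandwich_shift[OF T])
    fix e :: real assume e: "e > 0"
    \<comment> \<open>The two errors for window length \<open>M\<close>: uncoupled windows cost the
      first term on average, and the distance of \<open>A (Suc M)\<close> from \<open>I\<close> is
      at most the second.\<close>
    have "(\<lambda>M. 2 * B / p\<^sup>2 * (1 / real M) + (1 - p) ^ Suc M * (2 * B)) \<longlonglongrightarrow> 2 * B / p\<^sup>2 * 0 + 0 * (2 * B)"
      using p by (intro tendsto_intros lim_const_over_n LIMSEQ_Suc[OF LIMSEQ_realpow_zero]) auto
    then have "\<forall>\<^sub>F M in sequentially. 2 * B / p\<^sup>2 * (1 / real M) + (1 - p) ^ Suc M * (2 * B) < e"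
      by (rule order_tendstoD) (use e in simp)
    then have "\<forall>\<^sub>F M in sequentially. M \<ge> 1 \<and> 2 * B / p\<^sup>2 * (1 / real M) + (1 - p) ^ Suc M * (2 * B) < e"
      using eventually_ge_at_top[of 1] by eventually_elim simp
    then obtain M where M: "M \<ge> 1" "2 * B / p\<^sup>2 * (1 / real M) + (1 - p) ^ Suc M * (2 * B) < e"
      by (auto simp: eventually_sequentially)
    obtain E where E: "has_avg E 0" "\<And>l. 0 \<le> 1 / real M + E l"
      "\<And>l. \<forall>k\<in>{1..M}. block s v (l + k) \<notin> (\<Pi>\<^sub>E r\<in>{1..s}. {a r<..b r}) \<Longrightarrow> p\<^sup>2 \<le> 1 / real M + E l"
      by (rule cud_has_avg_uncoupled[where a = a and b = b, OF cud v s M(1) ab, folded p_def]) (assumption, rule that)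
    define w where "w l = mp_mean N \<Omega> \<pi> \<kappa> f (driven_chain \<phi> x0 (\<lambda>k. U (l + k)) M) (U (l + Suc M))" for l
    \<comment> \<open>A coupled window has error 0. On an uncoupled one the error is at most
      \<open>2 * B\<close>, and there \<open>1 / M + E l\<close> is at least the square of
      \<open>p\<close>; dividing by that square gives a bound valid for every window.\<close>
    define d where "d l = 2 * B / p\<^sup>2 * (1 / real M + E l)" for l
    have wB: "\<bar>w l\<bar> \<le> B" for l
      unfolding w_def by (rule mean_bound) (use chain[OF x0] U B(2) in auto)
    have close: "\<bar>T (l + M) - w l\<bar> \<le> d l" for l
    proof (cases "\<exists>k\<in>{1..M}. U (l + k) \<in> C")
      case True
      then obtain k where k: "k \<in> {1..M}" "U (l + k) \<in> C" by blast
      have "driven_chain \<phi> x0 U (l + M) = driven_chain \<phi> x0 (\<lambda>k. U (l + k)) M"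
        unfolding driven_chain_add
      proof (rule driven_chain_coupled[where S = \<Omega> and k = k])
        show "\<phi> y (U (l + k)) = \<phi> y' (U (l + k))" if "y \<in> \<Omega>" "y' \<in> \<Omega>" for y y'
          using k(2) that by (rule cpl)
      qed (use k(1) upd U x0 chain[OF x0, of 0] in auto)
      then have "T (l + M) = w l" by (simp add: T_def w_def)
      then show ?thesis using E(2)[of l] B(1) by (simp add: d_def)
    next
      case False
      then have "p\<^sup>2 \<le> 1 / real M + E l" using boxC by (intro E(3)) (auto simp: U_def)
      then have "2 * B / p\<^sup>2 * p\<^sup>2 \<le> d l" unfolding d_def using B(1) by (intro mult_left_mono) auto
      then have "2 * B \<le> d l" using p(1) by simp
      then show ?thesis using T[of "l + M"] wB[of l] by linarith
    qed
    have davg: "has_avg d (2 * B / p\<^sup>2 * (1 / real M + 0))"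
      unfolding d_def by (intro has_avg_cmult has_avg_add has_avg_const E(1))
    have wavg: "has_avg w (A (Suc M))" using window[of M] by (simp add: w_def[abs_def])
    have "has_avg (\<lambda>l. w l - d l) (A (Suc M) - 2 * B / p\<^sup>2 * (1 / real M + 0))"
      "has_avg (\<lambda>l. w l + d l) (A (Suc M) + 2 * B / p\<^sup>2 * (1 / real M + 0))"
      by (intro has_avg_diff has_avg_add wavg davg)+
    moreover have "w l - d l \<le> T (l + M) \<and> T (l + M) \<le> w l + d l" for l using close[of l] by linarith
    moreover have "I - e < A (Suc M) - 2 * B / p\<^sup>2 * (1 / real M + 0)"
      "A (Suc M) + 2 * B / p\<^sup>2 * (1 / real M + 0) < I + e"
      using M(2) doeblin[of "Suc M"] unfolding add_0_right by linarith+
    ultimately show "\<exists>k x y a b. has_avg x a \<and> has_avg y b \<and>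
        (\<forall>l. x l \<le> T (l + k) \<and> T (l + k) \<le> y l) \<and> I - e < a \<and> b < I + e"
      by blast
  qed
  then show ?thesis
    unfolding has_avg_def mp_estimator_eq I_def T_def U_def \<phi>_def .
qed

end
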